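(* Writing $E_a=\mathcal E_{a,17}$, the following hold: $-3E_2E_3+2E_7E_3+3E_{13}E_3+E_2E_7+E_2E_8+3E_2E_{11}-3E_5E_{11}+3E_7E_{11}-E_2E_{13}-3E_7E_{13}-3E_{11}E_{13}=0$; $-9E_2E_3+5E_7E_3+9E_{13}E_3-5E_2E_7-5E_2E_8+9E_1E_{11}+9E_2E_{11}+9E_7E_{11}+5E_2E_{13}-9E_{11}E_{13}=0$; $-3E_1E_5-3E_7E_5+3E_1E_7+E_2E_7+2E_3E_7+E_2E_8-3E_2E_{11}-3E_7E_{11}+2E_2E_{13}=0$; $-9E_2E_3+7E_7E_3+9E_8E_3+2E_2E_7+2E_2E_8+9E_7E_{11}+7E_2E_{13}-9E_7E_{13}=0$; $16E_2E_7-16E_3E_7+9E_8E_7+9E_1E_8+16E_2E_8-9E_2E_{11}-7E_2E_{13}=0$; $E_2E_7-3E_3E_5+2E_3E_7+E_2E_8-E_2E_{13}-3E_7E_{13}=0$.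
   Context: $q=e^{2\pi i\tau}$. For an odd Dirichlet character $\chi$ mod $17$, $E_{1,\chi}(\tau)=1+\frac{2}{L(0,\chi)}\sum_{n\ge1}\chi(n)\frac{q^n}{1-q^n}$ ($L(0,\chi)$ the value at $0$ of the continued $L$-function). For $a$ coprime to $17$, $\mathcal E_{a,17}=\frac{2}{16}\sum_{\chi\text{ odd mod }17}\chi(a)E_{1,\chi}$ (equivalently $(\gamma_{21}\tau+\gamma_{22})^{-1}\mathcal E_{1,17}(\gamma\tau)$ for $\gamma\in SL(2,\mathbb Z)$, $\gamma_{21}\equiv0$, $\gamma_{22}\equiv a\pmod{17}$). *)

theory Defs
  imports "HOL-Complex_Analysis.Complex_Analysis" "HOL-Number_Theory.Number_Theory"
begin

definition dirichlet_character :: "int \<Rightarrow> (int \<Rightarrow> complex) \<Rightarrow> bool" where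
  "dirichlet_character N chi \<longleftrightarrow>
     (\<forall>m. chi (m + N) = chi m) \<and>
     (\<forall>m n. chi (m * n) = chi m * chi n) \<and>
     (\<forall>m. chi m \<noteq> 0 \<longleftrightarrow> coprime m N)"

definition odd_characters :: "int \<Rightarrow> (int \<Rightarrow> complex) set" where
  "odd_characters N = {chi. dirichlet_character N chi \<and> chi (-1) = -1}"

definition L_series :: "(int \<Rightarrow> complex) \<Rightarrow> complex \<Rightarrow> complex" where
  "L_series chi s = (\<Sum>n. chi (int (Suc n)) / of_nat (Suc n) powr s)"

text \<open>
  \<open>F\<close> continues the Dirichlet series of \<open>chi\<close> analytically from \<open>Re z > 1\<close>
  to the half-plane \<open>Re z > c\<close>.
\<close>
definition continues_L_series :: "(int \<Rightarrow> complex) \<Rightarrow> real \<Rightarrow> (complex \<Rightarrow> complex) \<Rightarrow> bool" where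
  "continues_L_series chi c F \<longleftrightarrow>
     F holomorphic_on {z. Re z > c} \<and> (\<forall>z. Re z > 1 \<longrightarrow> F z = L_series chi z)"

text \<open>
  The value at \<open>s\<close> of the continued L-function. Half-planes are nested, so all
  continuations to half-planes containing \<open>s\<close> take the same value there (see
  \<open>Dirichlet_L_eqI\<close>). For a non-principal character the L-function is entire, so
  this is its value for every \<open>s\<close>; for a principal character it is
  meaningful only for \<open>Re s > 1\<close>.
\<close>
definition Dirichlet_L :: "complex \<Rightarrow> (int \<Rightarrow> complex) \<Rightarrow> complex" where
  "Dirichlet_L s chi = (THE w. \<exists>c F. c < Re s \<and> continues_L_series chi c F \<and> w = F s)"

definition E1 :: "(int \<Rightarrow> complex) \<Rightarrow> complex \<Rightarrow> complex" where
  "E1 chi \<tau> = (let q = exp (2 * of_real pi * \<i> * \<tau>) in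
     1 + 2 / Dirichlet_L 0 chi * (\<Sum>n. chi (int (Suc n)) * (q ^ Suc n / (1 - q ^ Suc n))))"

text \<open>The sum is over a finite set (see \<open>finite_odd_characters\<close>).\<close>
definition calE17 :: "int \<Rightarrow> complex \<Rightarrow> complex" where
  "calE17 a \<tau> = 2 / 16 * (\<Sum>chi\<in>odd_characters 17. chi a * E1 chi \<tau>)"

lemma continues_L_series_unique:
  assumes "continues_L_series chi c F" "continues_L_series chi d G" "c < Re s" "d < Re s"
  shows "F s = G s"
proof -
  define S where "S = {z. Re z > max c d}"
  define U where "U = {z. Re z > max 1 (max c d)}"
  have conv: "convex S" and op: "open S" "open U"
    unfolding S_def U_def by (rule convex_halfspace_Re_gt open_halfspace_Re_gt)+
  have FG: "F holomorphic_on S" "G holomorphic_on S"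
    using assms by (auto simp: continues_L_series_def S_def elim!: holomorphic_on_subset)
  have xi: "of_real (max 1 (max c d) + 1) \<in> U"
    unfolding U_def mem_Collect_eq Re_complex_of_real by linarith
  show ?thesis
  proof (rule analytic_continuation_open[of U S F G])
    show "open U" "open S" "connected S"
      using op conv by (auto intro: convex_connected)
    show "U \<noteq> {}" using xi by blast
    show "U \<subseteq> S" by (auto simp: U_def S_def)
    show "F holomorphic_on S" "G holomorphic_on S" by (fact FG)+
    show "F z = G z" if "z \<in> U" for z
      using that assms by (auto simp: U_def continues_L_series_def)
    show "s \<in> S" using assms by (simp add: S_def)
  qed
qed

lemma Dirichlet_L_eqI:
  assumes "continues_L_series chi c F" "c < Re s"
  shows "Dirichlet_L s chi = F s"
  unfolding Dirichlet_L_def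
proof (rule the_equality)
  show "\<exists>c' F'. c' < Re s \<and> continues_L_series chi c' F' \<and> F s = F' s"
    using assms by blast
qed (use assms continues_L_series_unique in blast)

lemma dirichlet_character_mod:
  assumes "dirichlet_character N chi"
  shows "chi (m mod N) = chi m"
proof -
  have per: "chi (x + N) = chi x" for x
    using assms by (simp add: dirichlet_character_def)
  have "chi (x + k * N) = chi x" for x k
  proof (induction k rule: int_induct[where k = 0])
    case (step1 i)
    then show ?case using per[of "x + i * N"] by (simp add: algebra_simps)
  next
    case (step2 i)
    then show ?case using per[of "x + (i - 1) * N"] by (simp add: algebra_simps)
  qed simp
  from this[of "m mod N" "m div N"] show ?thesis
    by simp
qed

lemma dirichlet_character_power:
  assumes "dirichlet_character N chi" "coprime m N" "N > 0"
  shows "chi m ^ totient (nat N) = 1"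
proof -
  have mult: "chi (x * y) = chi x * chi y" and nz: "chi x \<noteq> 0 \<longleftrightarrow> coprime x N" for x y
    using assms by (auto simp: dirichlet_character_def)
  have "chi 1 = chi 1 * chi 1" "chi 1 \<noteq> 0"
    using mult[of 1 1] nz[of 1] by simp_all
  hence one: "chi 1 = 1" by simp
  have pow: "chi (m ^ k) = chi m ^ k" for k
    by (induction k) (simp_all add: mult one)
  define r where "r = nat (m mod N)"
  have r: "int r = m mod N" using assms by (simp add: r_def)
  have "coprime (int r) N"
    using assms(2,3) by (simp add: r coprime_commute)
  hence "coprime r (nat N)"
    using assms(3) by (metis coprime_int_iff int_nat_eq order_less_imp_le)
  hence "[r ^ totient (nat N) = 1] (mod (nat N))"
    by (rule euler_theorem)
  hence "[int (r ^ totient (nat N)) = int 1] (mod (int (nat N)))"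
    by (simp only: cong_int_iff)
  hence "[(m mod N) ^ totient (nat N) = 1] (mod N)"
    using assms(3) by (simp add: r)
  hence "[m ^ totient (nat N) = 1] (mod N)"
    by (simp add: cong_def power_mod)
  hence "chi (m ^ totient (nat N)) = chi 1"
    by (metis assms(1) cong_def dirichlet_character_mod)
  thus ?thesis by (simp add: pow one)
qed

lemma finite_odd_characters:
  assumes "N > 0"
  shows "finite (odd_characters N)"
proof -
  let ?R = "insert 0 {z::complex. z ^ totient (nat N) = 1}"
  let ?g = "\<lambda>chi::int \<Rightarrow> complex. restrict chi {0..<N}"
  have fR: "finite ?R"
    using assms by (simp add: finite_roots_unity Suc_le_eq)
  have "?g ` odd_characters N \<subseteq> ({0..<N} \<rightarrow>\<^sub>E ?R)"
  proof (intro image_subsetI PiE_I)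
    fix chi m assume "chi \<in> odd_characters N" "m \<in> {0..<N}"
    thus "?g chi m \<in> ?R"
      using dirichlet_character_power[of N chi m] assms
      by (auto simp: odd_characters_def dirichlet_character_def)
  qed (auto simp: restrict_def)
  moreover have "finite ({0..<N} \<rightarrow>\<^sub>E ?R)"
    by (intro finite_PiE fR) auto
  moreover have "inj_on ?g (odd_characters N)"
  proof (rule inj_onI, rule ext)
    fix chi \<psi> m assume *: "chi \<in> odd_characters N" "\<psi> \<in> odd_characters N" "?g chi = ?g \<psi>"
    have "m mod N \<in> {0..<N}" using assms by simp
    hence "chi (m mod N) = \<psi> (m mod N)"
      using fun_cong[OF *(3), of "m mod N"] by simp
    thus "chi m = \<psi> m"
      using * by (simp add: odd_characters_def dirichlet_character_mod)
  qed
  ultimately show ?thesis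
    using finite_subset finite_imageD by blast
qed

end

theory Submission
  imports Defs
begin

text \<open>
  Put \<open>q = exp (2 \<pi> \<i> \<tau>)\<close>. For \<open>b\<close> prime to 17 let \<open>s b\<close> be the weight one Eisenstein series with constant
  term \<open>1/2 - b/17\<close> and Lambert coefficients \<open>1\<close> at \<open>n \<equiv> b\<close> and \<open>-1\<close> at \<open>n \<equiv> -b\<close>; it is the
  quasi-periodic zeta function of the elliptic curve with parameter \<open>q ^ 17\<close>, evaluated at the division point
  \<open>q ^ b\<close>. The classical identity \<open>(\<zeta> x + \<zeta> y + \<zeta> z)\<^sup>2 = \<wp> x + \<wp> y + \<wp> z\<close> for \<open>x + y + z = 0\<close> gives one
  quadratic relation for each of the 24 triples \<open>a + b + c = 17\<close>, and these involve only eight auxiliary values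
  of \<open>\<wp>\<close>. Since \<open>L(0, \<chi>) = \<Sum>b. \<chi> b (1/2 - b/17)\<close>, each \<open>L(0, \<chi>) E\<^bsub>1,\<chi>\<^esub>\<close> equals \<open>\<Sum>b. \<chi> b s b\<close>, and
  orthogonality of the odd characters turns this into \<open>2 s c = \<Sum>b. (1/2 - b/17) E (a b)\<close> with \<open>a c \<equiv> 1\<close>.
  After this substitution the six relations are linear combinations of the 24 in which the \<open>\<wp>\<close>-values cancel.
\<close>

section \<open>The value at 0 of the L-function of a periodic function\<close>

text \<open>Abel summation done twice. If \<open>S\<close> is periodic with mean \<open>m\<close>,
  subtracting \<open>m\<close> before the second summation keeps \<open>T\<close> bounded;
  \<open>h\<close> then enters the series only through second differences, which for
  \<open>n powr -s\<close> are smaller by two powers of \<open>n\<close>.\<close>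

lemma sum_mult_second_difference:
  fixes a h :: "nat \<Rightarrow> complex" and m :: complex
  defines "S \<equiv> \<lambda>K. \<Sum>k<K. a k"
  defines "T \<equiv> \<lambda>K. \<Sum>k<K. S (Suc k) - m"
  shows "(\<Sum>n<K. a n * h n) =
    (\<Sum>n<K. T (Suc n) * (h n - 2 * h (Suc n) + h (Suc (Suc n)))) + m * h 0
      + (S K - m) * h K + T K * (h K - h (Suc K))"
proof (induction K)
  case 0
  then show ?case by (simp add: S_def T_def)
next
  case (Suc K)
  have "T (Suc K) = T K + (S (Suc K) - m)" "S (Suc K) = S K + a K"
    by (simp_all add: T_def S_def)
  then show ?case
    by (simp add: Suc.IH) (simp add: algebra_simps)
qed

text \<open>A full period contributes zero, so a partial sum depends only on its length modulo
  \<open>N\<close> and takes finitely many values.\<close>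

lemma bounded_periodic_partial_sums:
  fixes a :: "nat \<Rightarrow> 'a::real_normed_vector"
  assumes "N > 0" "\<And>n. a (n + N) = a n" "(\<Sum>k<N. a k) = 0"
  shows "(\<Sum>k<n + N. a k) = (\<Sum>k<n. a k)"
    and "\<exists>C. \<forall>n. norm (\<Sum>k<n. a k) \<le> C"
proof -
  show per: "(\<Sum>k<n + N. a k) = (\<Sum>k<n. a k)" for n
    by (induction n) (use assms in simp_all)
  have "(\<Sum>k<n. a k) = (\<Sum>k<n mod N. a k)" for n
  proof (induction n rule: less_induct)
    case (less n)
    show ?case
    proof (cases "n < N")
      case False
      then have "(\<Sum>k<n. a k) = (\<Sum>k<n - N. a k)" using per[of "n - N"] by simp
      also have "\<dots> = (\<Sum>k<(n - N) mod N. a k)" using less False assms(1) by simp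
      also have "(n - N) mod N = n mod N" using False by (simp add: le_mod_geq)
      finally show ?thesis .
    qed simp
  qed
  moreover have "norm (\<Sum>k<n mod N. a k) \<le> (\<Sum>k<N. norm (a k))" for n
  proof -
    have "norm (\<Sum>k<n mod N. a k) \<le> (\<Sum>k<n mod N. norm (a k))" by (rule norm_sum)
    also have "\<dots> \<le> (\<Sum>k<N. norm (a k))"
      by (rule sum_mono2) (use assms(1) in \<open>auto intro: less_trans[OF _ mod_less_divisor]\<close>)
    finally show ?thesis .
  qed
  ultimately show "\<exists>C. \<forall>n. norm (\<Sum>k<n. a k) \<le> C" by metis
qed

text \<open>The second difference is \<open>g x - g (x + 1)\<close>, and the mean value inequality
  is applied twice: to \<open>g\<close>, and to \<open>z powr (-s-1)\<close> over the unit step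
  inside \<open>g'\<close>. All points are real and at least \<open>x\<close>;
  \<open>Re s > -2\<close> makes the exponent \<open>- Re s - 2\<close> negative, so its power is
  largest at \<open>x\<close>.\<close>

lemma norm_second_difference_powr_le:
  fixes s :: complex and x :: real
  assumes "x > 0" "Re s > -2"
  shows "norm (of_real x powr -s - 2 * of_real (x + 1) powr -s + of_real (x + 2) powr -s)
    \<le> norm s * norm (s + 1) * x powr (- Re s - 2)"
proof -
  define g where "g = (\<lambda>z::complex. z powr -s - (z + 1) powr -s)"
  define g' where "g' = (\<lambda>z::complex. (-s) * (z powr (-s-1) - (z + 1) powr (-s-1)))"
  have pos: "z \<in> \<real> \<and> Re z \<ge> y" if "z \<in> closed_segment (of_real y) (of_real (y+1))" for y and z :: complex
  proof -
    from that obtain u where "0 \<le> u" "z = (1 - u) *\<^sub>R of_real y + u *\<^sub>R of_real (y + 1)"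
      unfolding in_segment by blast
    then have "z = of_real (y + u)" "0 \<le> u" by (simp_all add: scaleR_conv_of_real algebra_simps)
    then show ?thesis by simp
  qed
  have pw: "norm (z powr w) \<le> y powr Re w" if "z \<in> closed_segment (of_real y) (of_real (y+1))" "Re w \<le> 0" "y > 0" for y and z w :: complex
    using pos[OF that(1)] that(2,3) by (simp add: norm_powr_real_powr powr_mono2')
  have nn: "z \<notin> \<real>\<^sub>\<le>\<^sub>0" if "z \<in> closed_segment (of_real y) (of_real (y+1))" "y > 0" for y and z :: complex
    using pos[OF that(1)] that(2) by (auto simp: complex_nonpos_Reals_iff)
  have nn1: "z + 1 \<notin> \<real>\<^sub>\<le>\<^sub>0" if "z \<in> closed_segment (of_real y) (of_real (y+1))" "y > 0" for y and z :: complex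
    using pos[OF that(1)] that(2) by (auto simp: complex_nonpos_Reals_iff)
  have b1: "norm (z powr (-s-1) - (z+1) powr (-s-1)) \<le> norm (s+1) * x powr (- Re s - 2)"
    if z: "z \<in> closed_segment (of_real x) (of_real (x+1))" for z
  proof -
    have "Im z = 0" using pos[OF z] by (simp add: complex_is_Real_iff)
    then have zr: "z = of_real (Re z)" by (simp add: complex_eq_iff)
    have zx: "Re z \<ge> x" using pos[OF z] by simp
    let ?C = "closed_segment z (z+1)"
    have C: "?C = closed_segment (of_real (Re z)) (of_real (Re z + 1))"
      using zr by (metis of_real_1 of_real_add)
    have "norm (z powr (-s-1) - (z+1) powr (-s-1)) \<le> (norm (s+1) * x powr (- Re s - 2)) * norm (z - (z+1))"
    proof (rule field_differentiable_bound[where S = ?C])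
      fix w assume w: "w \<in> ?C"
      have w': "w \<in> closed_segment (of_real (Re z)) (of_real (Re z + 1))" using w C by simp
      have zp: "Re z > 0" using zx assms by simp
      show "((\<lambda>z. z powr (- s - 1)) has_field_derivative (-s-1) * w powr (-s-2)) (at w within ?C)"
        using nn[OF w' zp] by (auto intro!: derivative_eq_intros simp: algebra_simps)
      have "norm (w powr (-s-2)) \<le> Re z powr Re (-s-2)"
        using pw[OF w' _ zp, of "-s-2"] assms by simp
      also have "\<dots> \<le> x powr (- Re s - 2)"
        using zx assms by (simp add: powr_mono2')
      finally have "norm (w powr (-s-2)) \<le> x powr (- Re s - 2)" .
      moreover have "norm (-s-1) = norm (s+1)"
        using norm_minus_cancel[of "s+1"] by simp
      ultimately show "norm ((-s-1) * w powr (-s-2)) \<le> norm (s+1) * x powr (- Re s - 2)"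
        unfolding norm_mult by (simp add: mult_left_mono)
    qed auto
    then show ?thesis by simp
  qed
  have "norm (g (of_real x) - g (of_real (x+1))) \<le> (norm s * (norm (s+1) * x powr (- Re s - 2))) * norm (of_real x - (of_real (x+1)) :: complex)"
  proof (rule field_differentiable_bound[where S = "closed_segment (of_real x) (of_real (x+1))" and f' = g'])
    fix z :: complex assume z: "z \<in> closed_segment (of_real x) (of_real (x+1))"
    show "(g has_field_derivative g' z) (at z within closed_segment (of_real x) (of_real (x+1)))"
      unfolding g_def g'_def using nn[OF z assms(1)] nn1[OF z assms(1)]
      by (auto intro!: derivative_eq_intros simp: algebra_simps)
    show "norm (g' z) \<le> norm s * (norm (s+1) * x powr (- Re s - 2))"
      unfolding g'_def norm_mult using b1[OF z] by (simp add: mult_left_mono)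
  qed auto
  then show ?thesis
    by (simp add: g_def algebra_simps)
qed

text \<open>Two summations by parts turn the Dirichlet series into \<open>m * h s 0\<close> plus a
  series with terms of order \<open>n powr (- Re s - 2)\<close>, which converges locally uniformly
  past \<open>Re s = 0\<close>. At \<open>s = 0\<close> all second differences vanish, so the value
  is \<open>m\<close>, the Cesaro mean of the partial sums.\<close>

lemma continues_L_series_periodic:
  fixes chi :: "int \<Rightarrow> complex" and N :: nat
  assumes N: "N > 0" and per: "\<And>k. chi (k + int N) = chi k"
    and zero: "(\<Sum>k=1..N. chi (int k)) = 0"
  shows "\<exists>F. continues_L_series chi (-1/2) F \<and> F 0 = - (\<Sum>k=1..N. of_nat k * chi (int k)) / of_nat N"
proof -
  define a where "a = (\<lambda>k. chi (int (Suc k)))"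
  define S where "S = (\<lambda>K. \<Sum>k<K. a k)"
  \<comment> \<open>With this mean \<open>S (Suc k) - m\<close> again has period \<open>N\<close>
    and sum zero, so \<open>bounded_periodic_partial_sums\<close> applies a second time and bounds
    \<open>T\<close>.\<close>
  define m where "m = (\<Sum>k<N. S (Suc k)) / of_nat N"
  define T where "T = (\<lambda>K. \<Sum>k<K. S (Suc k) - m)"
  define h where "h = (\<lambda>(s::complex) n. of_nat (Suc n) powr -s)"
  define D where "D = (\<lambda>s n. h s n - 2 * h s (Suc n) + h s (Suc (Suc n)))"
  have reidx: "(\<Sum>k=1..N. g k) = (\<Sum>k<N. g (Suc k))" for g :: "nat \<Rightarrow> complex"
    by (rule sum.reindex_bij_witness[of _ Suc "\<lambda>k. k - 1"]) auto
  have aper: "a (n + N) = a n" for n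
    using per[of "int (Suc n)"] by (simp add: a_def algebra_simps)
  have azero: "(\<Sum>k<N. a k) = 0"
    using zero unfolding reidx by (simp add: a_def)
  note A = bounded_periodic_partial_sums[OF N aper azero]
  obtain C1 where C1: "\<And>n. norm (S n) \<le> C1" using A(2) unfolding S_def by blast
  have Sper: "S (Suc (n + N)) - m = S (Suc n) - m" for n
    using A(1)[of "Suc n"] unfolding S_def by simp
  have Szero: "(\<Sum>k<N. S (Suc k) - m) = 0"
    using N by (simp add: sum_subtractf m_def)
  obtain C2 where C2: "\<And>n. norm (T n) \<le> C2"
    using bounded_periodic_partial_sums(2)[where a = "\<lambda>k. S (Suc k) - m", OF N Sper Szero]
    unfolding T_def by blast
  have C2_nn: "C2 \<ge> 0" using norm_ge_zero[of "T 0"] C2[of 0] by linarith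
  have parts: "(\<Sum>n<K. a n * h s n) = (\<Sum>n<K. T (Suc n) * D s n) + m * h s 0
      + (S K - m) * h s K + T K * (h s K - h s (Suc K))" for s K
    unfolding S_def T_def D_def by (rule sum_mult_second_difference)
  have D_le: "norm (D s n) \<le> norm s * norm (s + 1) * of_nat (Suc n) powr (- Re s - 2)"
    if "Re s > -2" for s n
    using norm_second_difference_powr_le[of "of_nat (Suc n)" s] that
    by (simp add: D_def h_def add_ac)
  define F where "F = (\<lambda>s. m * h s 0 + (\<Sum>n. T (Suc n) * D s n))"
  have ulim: "uniform_limit (cball x r) (\<lambda>K s. \<Sum>n<K. T (Suc n) * D s n) (\<lambda>s. \<Sum>n. T (Suc n) * D s n) sequentially"
    if sub: "cball x r \<subseteq> {s. Re s > -1/2}" for x r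
  proof (rule Weierstrass_m_test)
    \<comment> \<open>On the ball \<open>norm s\<close> is at most \<open>?R\<close>, and
      \<open>Re s > -1/2\<close> yields the summable exponent \<open>-3/2\<close>, so the majorant
      does not depend on \<open>s\<close>.\<close>
    let ?R = "norm x + r"
    show "norm (T (Suc n) * D s n) \<le> C2 * (?R * (?R + 1) * of_nat (Suc n) powr (-3/2))"
      if s: "s \<in> cball x r" for s n
    proof -
      have re: "Re s > -1/2" using sub s by blast
      have R: "norm s \<le> ?R"
        using s norm_triangle_sub[of s x] by (simp add: dist_norm norm_minus_commute)
      have R0: "0 \<le> ?R" using R norm_ge_zero[of s] by linarith
      have R1: "norm (s + 1) \<le> ?R + 1"
        using norm_triangle_ineq[of s 1] R by simp
      have "- Re s - 2 \<le> -3/2" using re by (simp add: field_simps)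
      then have p: "real (Suc n) powr (- Re s - 2) \<le> real (Suc n) powr (-3/2)"
        by (rule powr_mono) simp
      have "norm (D s n) \<le> norm s * norm (s + 1) * of_nat (Suc n) powr (- Re s - 2)"
        using re by (intro D_le) simp
      also have "\<dots> \<le> ?R * (?R + 1) * of_nat (Suc n) powr (-3/2)"
        using R R1 p R0 by (intro mult_mono mult_nonneg_nonneg) auto
      finally show ?thesis
        unfolding norm_mult using C2 C2_nn by (intro mult_mono) auto
    qed
    have "summable (\<lambda>n. real n powr (-3/2))"
      by (simp add: summable_real_powr_iff)
    then have "summable (\<lambda>n. real (Suc n) powr (-3/2))"
      by (subst summable_Suc_iff)
    then show "summable (\<lambda>n. C2 * (?R * (?R + 1) * real (Suc n) powr (-3/2)))"
      by (intro summable_mult)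
  qed
  have ball_sub: "\<exists>d>0. cball x d \<subseteq> {s. Re s > -1/2}" if "Re x > -1/2" for x
    using open_halfspace_Re_gt[of "-1/2"] that unfolding open_contains_cball by simp
  have hol_h: "(\<lambda>s. h s n) holomorphic_on A" for n A
    unfolding h_def by (intro holomorphic_intros) (simp_all add: complex_nonpos_Reals_iff)
  have hol_D: "(\<lambda>s. \<Sum>n. T (Suc n) * D s n) holomorphic_on {s. Re s > -1/2}"
  proof (rule holomorphic_uniform_sequence)
    show "open {s. Re s > -1/2}" by (rule open_halfspace_Re_gt)
    show "(\<lambda>s. \<Sum>n<K. T (Suc n) * D s n) holomorphic_on {s. Re s > -1/2}" for K
      unfolding D_def by (intro holomorphic_intros hol_h)
    show "\<exists>d>0. cball x d \<subseteq> {s. Re s > -1/2} \<and>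
      uniform_limit (cball x d) (\<lambda>K s. \<Sum>n<K. T (Suc n) * D s n) (\<lambda>s. \<Sum>n. T (Suc n) * D s n) sequentially"
      if "x \<in> {s. Re s > -1/2}" for x
      using ball_sub[of x] that ulim[of x] by auto
  qed
  have "F holomorphic_on {s. Re s > -1/2}"
    unfolding F_def by (intro holomorphic_intros hol_h hol_D)
  moreover have "F s = L_series chi s" if s: "Re s > 1" for s
  proof -
    have "(\<lambda>K. \<Sum>n<K. T (Suc n) * D s n) \<longlonglongrightarrow> (\<Sum>n. T (Suc n) * D s n)"
    proof -
      obtain d where d: "d > 0" "cball s d \<subseteq> {s. Re s > -1/2}"
        using ball_sub[of s] s by auto
      show ?thesis
        using tendsto_uniform_limitI[OF ulim[OF d(2)], of s] d(1) by simp
    qed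
    moreover have h0: "(\<lambda>K. h s K) \<longlonglongrightarrow> 0"
    proof (rule tendsto_norm_zero_cancel)
      have "(\<lambda>K. real (Suc K) powr (- Re s)) \<longlonglongrightarrow> 0"
        using s by (intro tendsto_neg_powr filterlim_compose[OF filterlim_real_sequentially] filterlim_Suc) auto
      then show "(\<lambda>K. norm (h s K)) \<longlonglongrightarrow> 0"
        unfolding h_def by (subst norm_powr_real_powr) (simp_all del: of_nat_Suc)
    qed
    \<comment> \<open>\<open>S\<close> and \<open>T\<close> are bounded and \<open>h s K\<close>
      tends to 0, so both boundary terms of \<open>parts\<close> disappear in the limit.\<close>
    moreover have "(\<lambda>K. (S K - m) * h s K) \<longlonglongrightarrow> 0"
    proof (rule Lim_null_comparison)
      show "\<forall>\<^sub>F K in sequentially. norm ((S K - m) * h s K) \<le> (C1 + norm m) * norm (h s K)"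
        unfolding norm_mult using C1 by (intro always_eventually allI mult_right_mono order.trans[OF norm_triangle_ineq4] add_right_mono) auto
      show "(\<lambda>K. (C1 + norm m) * norm (h s K)) \<longlonglongrightarrow> 0"
        using tendsto_norm_zero[OF h0] tendsto_mult_right_zero by blast
    qed
    moreover have "(\<lambda>K. T K * (h s K - h s (Suc K))) \<longlonglongrightarrow> 0"
    proof (rule Lim_null_comparison)
      show "\<forall>\<^sub>F K in sequentially. norm (T K * (h s K - h s (Suc K))) \<le> C2 * norm (h s K - h s (Suc K))"
        unfolding norm_mult using C2 by (intro always_eventually allI mult_right_mono) auto
      have "(\<lambda>K. h s K - h s (Suc K)) \<longlonglongrightarrow> 0"
        using tendsto_diff[OF h0 LIMSEQ_Suc[OF h0]] by simp
      then show "(\<lambda>K. C2 * norm (h s K - h s (Suc K))) \<longlonglongrightarrow> 0"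
        using tendsto_norm_zero tendsto_mult_right_zero by blast
    qed
    ultimately have "(\<lambda>K. \<Sum>n<K. a n * h s n) \<longlonglongrightarrow> (\<Sum>n. T (Suc n) * D s n) + m * h s 0 + 0 + 0"
      unfolding parts by (intro tendsto_add tendsto_const)
    then have "(\<lambda>n. a n * h s n) sums F s"
      by (simp add: sums_def F_def add.commute)
    moreover have "a n * h s n = chi (int (Suc n)) / of_nat (Suc n) powr s" for n
      unfolding a_def h_def powr_minus by (simp add: field_simps)
    ultimately show ?thesis
      by (simp add: L_series_def sums_iff)
  qed
  moreover have "F 0 = - (\<Sum>k=1..N. of_nat k * chi (int k)) / of_nat N"
  proof -
    have "h 0 n = 1" for n by (simp add: h_def del: of_nat_Suc)
    then have "F 0 = m" by (simp add: F_def D_def)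
    \<comment> \<open>Exchanging the summations gives \<open>a k\<close> the weight
      \<open>N - k = Suc N - Suc k\<close>; since the \<open>a k\<close> sum to zero, only
      \<open>- Suc k\<close> survives, and \<open>Suc k\<close> is the argument of
      \<open>chi\<close>.\<close>
    have swap: "(\<Sum>n<M. \<Sum>k<Suc n. a k) = (\<Sum>k<M. of_nat (M - k) * a k)" for M
      by (induction M) (simp_all add: Suc_diff_le sum.distrib distrib_right)
    have "(\<Sum>n<N. S (Suc n)) = (\<Sum>k<N. of_nat (N - k) * a k)"
      unfolding S_def by (rule swap)
    also have "\<dots> = (\<Sum>k<N. of_nat (Suc N) * a k - of_nat (Suc k) * a k)"
      by (intro sum.cong refl) (auto simp: of_nat_diff algebra_simps)
    also have "\<dots> = - (\<Sum>k<N. of_nat (Suc k) * a k)"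
      unfolding sum_subtractf sum_distrib_left[symmetric] azero by simp
    also have "\<dots> = - (\<Sum>k=1..N. of_nat k * chi (int k))"
      unfolding reidx by (simp add: a_def)
    finally show ?thesis using \<open>F 0 = m\<close> by (simp add: m_def)
  qed
  ultimately show ?thesis
    unfolding continues_L_series_def by blast
qed

lemma Dirichlet_L_0_periodic:
  fixes chi :: "int \<Rightarrow> complex" and N :: nat
  assumes "N > 0" "\<And>k. chi (k + int N) = chi k" "(\<Sum>k=1..N. chi (int k)) = 0"
  shows "Dirichlet_L 0 chi = - (\<Sum>k=1..N. of_nat k * chi (int k)) / of_nat N"
  using continues_L_series_periodic[of N chi] assms Dirichlet_L_eqI[of chi "-1/2" _ 0] by auto

section \<open>Bilateral Lambert series\<close>

lemma has_sum_product_abs: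
  fixes f :: "'a \<Rightarrow> complex" and g :: "'b \<Rightarrow> complex"
  assumes "(\<lambda>x. norm (f x)) summable_on A" "(\<lambda>y. norm (g y)) summable_on B"
  shows "((\<lambda>(x, y). f x * g y) has_sum (infsum f A * infsum g B)) (A \<times> B)"
proof (rule has_sum_SigmaI)
  have "(\<lambda>z. norm (case z of (x, y) \<Rightarrow> f x * g y)) summable_on A \<times> B"
  proof (rule summable_on_SigmaI)
    show "((\<lambda>y. norm (case (x, y) of (x, y) \<Rightarrow> f x * g y)) has_sum norm (f x) * infsum (\<lambda>y. norm (g y)) B) B" for x
      using has_sum_cmult_right[OF has_sum_infsum[OF assms(2)], of "norm (f x)"] by (simp add: norm_mult)
    show "(\<lambda>x. norm (f x) * infsum (\<lambda>y. norm (g y)) B) summable_on A"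
      using assms(1) by (rule summable_on_cmult_left)
  qed simp
  then show "(\<lambda>(x, y). f x * g y) summable_on A \<times> B"
    by (rule abs_summable_summable)
  show "((\<lambda>y. case (x, y) of (x, y) \<Rightarrow> f x * g y) has_sum f x * infsum g B) B" for x
    using has_sum_cmult_right[OF has_sum_infsum[OF abs_summable_summable[OF assms(2)]], of "f x"] by simp
  show "((\<lambda>x. f x * infsum g B) has_sum infsum f A * infsum g B) A"
    by (rule has_sum_cmult_left[OF has_sum_infsum[OF abs_summable_summable[OF assms(1)]]])
qed

lemma summable_on_power_nat_abs:
  fixes r :: real
  assumes "0 \<le> r" "r < 1"
  shows "(\<lambda>m::int. r ^ nat \<bar>m\<bar>) summable_on A"
proof -
  have "(\<lambda>n. r ^ n) summable_on UNIV"
    using assms by (intro summable_nonneg_imp_summable_on summable_geometric) auto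
  then have nat: "(\<lambda>n. r ^ n) summable_on B" for B by (rule summable_on_subset) simp
  have "(\<lambda>m::int. r ^ nat \<bar>m\<bar>) summable_on {0..}"
    using nat[of UNIV]
    by (subst summable_on_reindex_bij_witness[where j = nat and i = int and T = UNIV and h = "\<lambda>n. r ^ n"]) auto
  moreover have "(\<lambda>m::int. r ^ nat \<bar>m\<bar>) summable_on {..<0}"
    using nat[of "{0<..}"]
    by (subst summable_on_reindex_bij_witness[where j = "\<lambda>m. nat (-m)" and i = "\<lambda>n. - int n" and T = "{0<..}" and h = "\<lambda>n. r ^ n"]) auto
  ultimately have "(\<lambda>m::int. r ^ nat \<bar>m\<bar>) summable_on ({0..} \<union> {..<0})"
    by (rule summable_on_Un_disjoint) auto
  then show ?thesis by (rule summable_on_subset) auto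
qed

text \<open>
  On the annulus \<open>norm Q < norm x < 1\<close>, \<open>1/2 + lambertL Q x\<close> is the quasi-periodic zeta function
  of the Tate curve with parameter \<open>Q\<close>.
\<close>
definition lambertL :: "complex \<Rightarrow> complex \<Rightarrow> complex" where
  "lambertL Q x = (\<Sum>\<^sub>\<infinity>m\<in>-{0::int}. x powi m / (1 - Q powi m))"

text \<open>These are the diagonal terms \<open>m = n\<close> of the double series for
  \<open>lambertL Q u * lambertL Q v\<close> with \<open>x = u * v\<close>.\<close>

definition lambertV :: "complex \<Rightarrow> complex \<Rightarrow> complex" where
  "lambertV Q x = (\<Sum>\<^sub>\<infinity>m\<in>-{0::int}. x powi m / (1 - Q powi m)\<^sup>2)"

context
  fixes Q :: complex
  assumes Q0: "Q \<noteq> 0" and Q1: "norm Q < 1"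
begin

lemma power_int_neq_1:
  assumes "m \<noteq> (0::int)"
  shows "Q powi m \<noteq> 1"
proof
  assume *: "Q powi m = 1"
  have "norm Q ^ n < 1" if "n > 0" for n
    using Q1 that by (simp add: power_less_one_iff)
  moreover have "norm Q ^ nat \<bar>m\<bar> = 1"
  proof (cases "m > 0")
    case True
    then show ?thesis using * by (metis abs_of_pos norm_one norm_power power_int_def less_imp_le)
  next
    case False
    have "inverse (Q ^ nat (-m)) = 1" using * False assms by (simp add: power_int_def power_inverse)
    then have "Q ^ nat (-m) = 1" by simp
    then have "norm Q ^ nat (-m) = 1" by (metis norm_one norm_power)
    then show ?thesis using False by simp
  qed
  moreover have "nat \<bar>m\<bar> > 0" using assms by simp
  ultimately show False by (metis less_irrefl)
qed

text \<open>For \<open>m = -k < 0\<close> the kernel is \<open>- Q^k / (1 - Q^k)\<close> and decays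
  by itself. This compensates the growth of \<open>x powi m\<close> at negative \<open>m\<close>, so
  the bilateral series converge for \<open>norm Q < norm x < 1\<close>.\<close>

lemma norm_lambert_kernel_le:
  assumes "m \<noteq> (0::int)"
  shows "norm (1 / (1 - Q powi m)) \<le> 1 / (1 - norm Q)"
    and "m < 0 \<Longrightarrow> norm (1 / (1 - Q powi m)) \<le> norm Q ^ nat (-m) / (1 - norm Q)"
proof -
  have pos: "norm (1 / (1 - Q ^ k)) \<le> 1 / (1 - norm Q)" if "k > 0" for k
  proof -
    have "norm Q ^ k \<le> norm Q ^ 1" using that Q1 by (intro power_decreasing) auto
    moreover have "1 - norm (Q ^ k) \<le> norm (1 - Q ^ k)"
      using norm_triangle_ineq2[of 1 "Q ^ k"] by simp
    ultimately have "1 - norm Q \<le> norm (1 - Q ^ k)" by (simp add: norm_power)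
    then show ?thesis using Q1 by (simp add: norm_divide frac_le)
  qed
  have neg: "norm (1 / (1 - Q powi m)) \<le> norm Q ^ nat (-m) / (1 - norm Q)" if "m < 0"
  proof -
    define k where "k = nat (-m)"
    have k: "k > 0" "m = - int k" using that by (auto simp: k_def)
    have "Q ^ k \<noteq> 1" using power_int_neq_1[of "int k"] k by simp
    then have "1 / (1 - Q powi m) = - (Q ^ k) * (1 / (1 - Q ^ k))"
      using Q0 by (simp add: k power_int_minus divide_simps) (simp add: algebra_simps)
    then have "norm (1 / (1 - Q powi m)) = norm Q ^ k * norm (1 / (1 - Q ^ k))"
      by (simp only: norm_mult norm_power norm_minus_cancel)
    also have "\<dots> \<le> norm Q ^ k * (1 / (1 - norm Q))"
      by (intro mult_left_mono pos k) simp
    finally show ?thesis by (simp add: k_def)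
  qed
  show "m < 0 \<Longrightarrow> norm (1 / (1 - Q powi m)) \<le> norm Q ^ nat (-m) / (1 - norm Q)" by (rule neg)
  show "norm (1 / (1 - Q powi m)) \<le> 1 / (1 - norm Q)"
  proof (cases "m < 0")
    case True
    have "norm Q ^ nat (-m) \<le> 1" using Q1 by (intro power_le_one) auto
    then have "norm Q ^ nat (-m) / (1 - norm Q) \<le> 1 / (1 - norm Q)"
      using Q1 by (intro divide_right_mono) auto
    with neg[OF True] show ?thesis by linarith
  next
    case False
    then show ?thesis using assms pos[of "nat m"] by (simp add: power_int_def)
  qed
qed

lemma lambert_abs_summable:
  assumes "norm Q < norm x" "norm x < 1"
  shows "(\<lambda>m. norm (x powi m / (1 - Q powi m))) summable_on -{0::int}"
    and "(\<lambda>m. norm (x powi m / (1 - Q powi m)\<^sup>2)) summable_on -{0::int}"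
proof -
  \<comment> \<open>One ratio for both directions: positive indices decay like powers of
    \<open>norm x\<close>, negative ones like powers of \<open>norm Q / norm x\<close>.\<close>
  define r where "r = max (norm x) (norm Q / norm x)"
  define C where "C = 1 / (1 - norm Q)"
  have x0: "norm x > 0" using assms(1) norm_ge_zero[of Q] by linarith
  have r: "0 \<le> r" "r < 1" using assms x0 by (simp_all add: r_def le_max_iff_disj)
  have C: "C \<ge> 0" using Q1 by (simp add: C_def)
  have L: "norm (x powi m / (1 - Q powi m)) \<le> C * r ^ nat \<bar>m\<bar>" if m: "m \<noteq> 0" for m
  proof (cases "m < 0")
    case True
    have "norm (x powi m / (1 - Q powi m)) = norm (1 / (1 - Q powi m)) / norm x ^ nat (-m)"
      using True by (simp add: norm_mult norm_inverse norm_power power_int_def power_inverse divide_inverse)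
    also have "\<dots> \<le> norm Q ^ nat (-m) / (1 - norm Q) / norm x ^ nat (-m)"
      by (intro divide_right_mono norm_lambert_kernel_le(2) m True) simp
    also have "\<dots> = C * (norm Q / norm x) ^ nat (-m)"
      by (simp add: C_def power_divide)
    also have "\<dots> \<le> C * r ^ nat (-m)"
      by (intro mult_left_mono power_mono C) (auto simp: r_def)
    finally show ?thesis using True by simp
  next
    case False
    have "norm (x powi m / (1 - Q powi m)) = norm x ^ nat m * norm (1 / (1 - Q powi m))"
      using False by (simp add: norm_divide power_int_def norm_power)
    also have "\<dots> \<le> r ^ nat m * C"
      unfolding C_def using r by (intro mult_mono norm_lambert_kernel_le(1) m power_mono) (auto simp: r_def)
    finally show ?thesis using False by (simp add: mult.commute)
  qed
  have V: "norm (x powi m / (1 - Q powi m)\<^sup>2) \<le> C * (C * r ^ nat \<bar>m\<bar>)" if m: "m \<noteq> 0" for m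
  proof -
    have "norm (x powi m / (1 - Q powi m)\<^sup>2) = norm (1 / (1 - Q powi m)) * norm (x powi m / (1 - Q powi m))"
      by (simp add: norm_divide norm_mult norm_power power2_eq_square)
    also have "\<dots> \<le> C * (C * r ^ nat \<bar>m\<bar>)"
      using L[OF m] norm_lambert_kernel_le(1)[OF m] C by (intro mult_mono) (auto simp: C_def)
    finally show ?thesis .
  qed
  have s: "(\<lambda>m::int. C * r ^ nat \<bar>m\<bar>) summable_on -{0}"
    by (intro summable_on_cmult_right summable_on_power_nat_abs r)
  show "(\<lambda>m. norm (x powi m / (1 - Q powi m))) summable_on -{0::int}"
    by (rule Infinite_Sum.abs_summable_on_comparison_test'[OF s]) (use L in auto)
  show "(\<lambda>m. norm (x powi m / (1 - Q powi m)\<^sup>2)) summable_on -{0::int}"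
    by (rule Infinite_Sum.abs_summable_on_comparison_test'[OF summable_on_cmult_right[OF s]]) (use V in auto)
qed

lemma lambert_has_sum:
  assumes "norm Q < norm x" "norm x < 1"
  shows "((\<lambda>m. x powi m / (1 - Q powi m)) has_sum lambertL Q x) (-{0})"
    and "((\<lambda>m. x powi m / (1 - Q powi m)\<^sup>2) has_sum lambertV Q x) (-{0})"
  unfolding lambertL_def lambertV_def
  using has_sum_infsum[OF abs_summable_summable[OF lambert_abs_summable(1)[OF assms]]]
    has_sum_infsum[OF abs_summable_summable[OF lambert_abs_summable(2)[OF assms]]] by auto

lemma lambert_kernel_minus:
  assumes "m \<noteq> (0::int)"
  shows "1 / (1 - Q powi (-m)) = 1 - 1 / (1 - Q powi m)"
proof -
  define Y where "Y = Q powi m"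
  have "Y \<noteq> 0" "Y \<noteq> 1" using power_int_neq_1[OF assms] Q0 by (simp_all add: Y_def)
  then have "1 / (1 - inverse Y) = 1 - 1 / (1 - Y)"
    by (simp add: divide_simps) (simp add: algebra_simps)
  then show ?thesis by (simp add: Y_def power_int_minus)
qed

text \<open>Reverse the summation index. On the Tate curve \<open>Q / x\<close> is the inverse of
  \<open>x\<close>, so the first equation is an oddness statement; the extra \<open>lambertL\<close>
  in the second is what the linear term of \<open>lambert_U\<close> later absorbs.\<close>

lemma lambert_reflect:
  assumes "norm Q < norm x" "norm x < 1"
  shows "lambertL Q (Q / x) = - lambertL Q x"
    and "lambertV Q (Q / x) = lambertV Q x - lambertL Q x"
proof -
  have x0: "x \<noteq> 0" using assms(1) by auto
  have flip: "infsum f (-{0::int}) = infsum (\<lambda>m. f (-m)) (-{0})" for f :: "int \<Rightarrow> complex"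
    by (rule infsum_reindex_bij_witness[of _ uminus uminus]) auto
  have k1: "(Q / x) powi (-m) / (1 - Q powi (-m)) = - (x powi m / (1 - Q powi m))"
    and k2: "(Q / x) powi (-m) / (1 - Q powi (-m))\<^sup>2 = x powi m / (1 - Q powi m)\<^sup>2 - x powi m / (1 - Q powi m)"
    if "m \<noteq> 0" for m
  proof -
    define X Y where "X = x powi m" and "Y = Q powi m"
    have XY: "(Q / x) powi (-m) = X / Y" "Q powi (-m) = 1 / Y"
      by (simp_all add: X_def Y_def power_int_minus power_int_divide_distrib inverse_eq_divide)
    have Y: "Y \<noteq> 0" "Y \<noteq> 1" using power_int_neq_1[OF that] Q0 by (simp_all add: Y_def)
    have *: "1 / (1 - 1 / Y) = - Y / (1 - Y)"
      using Y by (simp add: divide_simps) (simp add: algebra_simps)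
    have "X / Y / (1 - 1 / Y) = X / Y * (- Y / (1 - Y))"
      unfolding *[symmetric] by (rule divide_inverse[unfolded inverse_eq_divide])
    then show "(Q / x) powi (-m) / (1 - Q powi (-m)) = - (x powi m / (1 - Q powi m))"
      using Y unfolding XY by (simp add: X_def Y_def)
    have "X / Y / (1 - 1 / Y)\<^sup>2 = X / Y * (- Y / (1 - Y))\<^sup>2"
      unfolding *[symmetric] power_one_over by (rule divide_inverse[unfolded inverse_eq_divide])
    also have "\<dots> = X / (1 - Y)\<^sup>2 - X / (1 - Y)"
    proof -
      have "(- Y / (1 - Y))\<^sup>2 / Y = 1 / (1 - Y)\<^sup>2 - 1 / (1 - Y)"
        using Y by (simp add: power2_eq_square divide_simps)
      then have "X * ((- Y / (1 - Y))\<^sup>2 / Y) = X * (1 / (1 - Y)\<^sup>2 - 1 / (1 - Y))"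
        by (rule arg_cong)
      then show ?thesis by (simp add: right_diff_distrib)
    qed
    finally show "(Q / x) powi (-m) / (1 - Q powi (-m))\<^sup>2 =
        x powi m / (1 - Q powi m)\<^sup>2 - x powi m / (1 - Q powi m)"
      unfolding XY by (simp add: X_def Y_def)
  qed
  show "lambertL Q (Q / x) = - lambertL Q x"
  proof -
    have "lambertL Q (Q / x) = infsum (\<lambda>m. - (x powi m / (1 - Q powi m))) (-{0})"
      unfolding lambertL_def by (subst flip, rule infsum_cong, rule k1) simp
    then show ?thesis by (simp add: infsum_uminus lambertL_def)
  qed
  have "lambertV Q (Q / x) = infsum (\<lambda>m. x powi m / (1 - Q powi m)\<^sup>2 - x powi m / (1 - Q powi m)) (-{0})"
    unfolding lambertV_def by (subst flip, rule infsum_cong, rule k2) simp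
  also have "\<dots> = lambertV Q x - lambertL Q x"
    using has_sum_add[OF lambert_has_sum(2)[OF assms] has_sum_uminusI[OF lambert_has_sum(1)[OF assms]]]
    by (intro infsumI) simp
  finally show "lambertV Q (Q / x) = lambertV Q x - lambertL Q x" .
qed

text \<open>
  With \<open>A = Q powi m\<close> and \<open>B = Q powi n\<close>, the partial fraction identity
  \<open>1 / ((1 - A) (1 - B)) = (1 / (1 - A) + 1 / (1 - B) - 1) / (1 - A B)\<close> splits the double series
  for \<open>lambertL Q (u v) * lambertL Q v\<close>, up to boundary terms, into those for
  \<open>lambertL Q u * lambertL Q v\<close> and \<open>lambertL Q (u v) * lambertL Q u\<close>. The splitting
  \<open>f m + f n - 1 = f m - f (-n)\<close> keeps both pieces absolutely convergent.
\<close>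
lemma lambert_product:
  assumes u: "norm Q < norm u" "norm u < 1" and v: "norm Q < norm v" "norm v < 1"
    and uv: "norm Q < norm (u * v)"
  shows "lambertL Q (u * v) * (lambertL Q u + lambertL Q v) - lambertL Q u * lambertL Q v =
    lambertL Q u + lambertL Q v - lambertV Q u - lambertV Q v - lambertV Q (u * v)"
proof -
  define f where "f = (\<lambda>m::int. 1 / (1 - Q powi m))"
  define A where "A = -{0::int}"
  define x where "x = u * v"
  have u0: "u \<noteq> 0" and v0: "v \<noteq> 0" using u v by auto
  have x: "norm Q < norm x" "norm x < 1"
    using uv mult_strict_mono[OF u(2) v(2)] by (simp_all add: x_def norm_mult)
  have x0: "x \<noteq> 0" using u0 v0 by (simp add: x_def)
  have L: "((\<lambda>m. z powi m * f m) has_sum lambertL Q z) A"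
    and V: "((\<lambda>m. z powi m * (f m)\<^sup>2) has_sum lambertV Q z) A"
    if "norm Q < norm z" "norm z < 1" for z
    using lambert_has_sum[OF that] by (simp_all add: f_def A_def power_divide)
  have P: "((\<lambda>(m, n). (z powi m * f m) * (w powi n * f n)) has_sum lambertL Q z * lambertL Q w) (A \<times> A)"
    if z: "norm Q < norm z" "norm z < 1" "norm Q < norm w" "norm w < 1" for z w
    using has_sum_product_abs[OF lambert_abs_summable(1)[OF z(1,2)] lambert_abs_summable(1)[OF z(3,4)]]
    by (simp add: f_def A_def lambertL_def)
  have fm: "f (-m) = 1 - f m" if "m \<in> A" for m
    using lambert_kernel_minus that by (simp add: f_def A_def)
  \<comment> \<open>This evaluates the antidiagonal \<open>n = -m\<close> of a double series:
    \<open>f (-m) = 1 - f m\<close> turns \<open>f m * f (-m)\<close> into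
    \<open>f m - (f m)^2\<close>.\<close>
  have W: "((\<lambda>m. z powi m * (f m * f (-m))) has_sum lambertL Q z - lambertV Q z) A"
    if "norm Q < norm z" "norm z < 1" for z
  proof -
    have "((\<lambda>m. z powi m * f m + - (z powi m * (f m)\<^sup>2)) has_sum lambertL Q z + - lambertV Q z) A"
      by (intro has_sum_add has_sum_uminusI L V that)
    then show ?thesis
      unfolding diff_conv_add_uminus
      by (rule has_sum_cong[THEN iffD1, rotated]) (simp add: fm power2_eq_square algebra_simps)
  qed
  \<comment> \<open>The partial fractions involve \<open>f (m + n)\<close>, and \<open>f 0\<close>
    is a division by zero, so the antidiagonal is removed and accounted for separately by
    \<open>W\<close>.\<close>
  define D where "D = {(m, n). m \<in> A \<and> n \<in> A \<and> m + n \<noteq> (0::int)}"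
  have D_diff: "D = A \<times> A - (\<lambda>m. (m, -m)) ` A" by (auto simp: D_def A_def)
  have anti: "((\<lambda>(m, n). z powi m * w powi n * (f m * f n)) has_sum S - T) D"
    if "((\<lambda>(m, n). (z powi m * f m) * (w powi n * f n)) has_sum S) (A \<times> A)"
      "((\<lambda>m. (z / w) powi m * (f m * f (-m))) has_sum T) A" "w \<noteq> 0" for z w S T
    unfolding D_diff
  proof (rule has_sum_Diff)
    show "((\<lambda>(m, n). z powi m * w powi n * (f m * f n)) has_sum S) (A \<times> A)"
      using that(1) by (simp add: mult_ac case_prod_unfold)
    have "inj_on (\<lambda>m::int. (m, -m)) A" by (auto simp: inj_on_def)
    then show "((\<lambda>(m, n). z powi m * w powi n * (f m * f n)) has_sum T) ((\<lambda>m. (m, -m)) ` A)"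
      using that(2,3)
      by (simp add: has_sum_reindex o_def power_int_minus power_int_mult_distrib power_int_inverse divide_inverse)
  qed (auto simp: A_def)
  have F: "((\<lambda>(m, n). x powi m * v powi n * (f m * f n)) has_sum
      lambertL Q x * lambertL Q v - (lambertL Q u - lambertV Q u)) D"
    using anti[OF P[OF x v] _ v0] W[OF u] v0 by (simp add: x_def)
  have H: "((\<lambda>(k, l). x powi k * u powi l * (f k * f l)) has_sum
      lambertL Q x * lambertL Q u - (lambertL Q v - lambertV Q v)) D"
    using anti[OF P[OF x u] _ u0] W[OF v] u0 by (simp add: x_def)
  have G: "((\<lambda>(m, k). u powi m * v powi k * (f m * f k)) has_sum
      lambertL Q u * lambertL Q v - lambertV Q x) (A \<times> A - (\<lambda>m. (m, m)) ` A)"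
  proof (rule has_sum_Diff)
    show "((\<lambda>(m, k). u powi m * v powi k * (f m * f k)) has_sum lambertL Q u * lambertL Q v) (A \<times> A)"
      using P[OF u v] by (simp add: mult_ac case_prod_unfold)
    have "inj_on (\<lambda>m::int. (m, m)) A" by (auto simp: inj_on_def)
    then show "((\<lambda>(m, k). u powi m * v powi k * (f m * f k)) has_sum lambertV Q x) ((\<lambda>m. (m, m)) ` A)"
      using V[OF x]
      by (simp add: has_sum_reindex o_def x_def power_int_mult_distrib power2_eq_square mult_ac)
  qed (auto simp: A_def)
  \<comment> \<open>Put \<open>k = m + n\<close>: the conditions \<open>k \<noteq> m\<close> and
    \<open>k \<noteq> 0\<close> become those defining \<open>D\<close>, and the monomial
    \<open>u^m v^k\<close> becomes \<open>x^m v^n\<close>.\<close>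
  have G': "((\<lambda>(m, n). u powi m * v powi (m + n) * (f m * f (m + n))) has_sum
      lambertL Q u * lambertL Q v - lambertV Q x) D"
    by (rule has_sum_reindex_bij_witness[where j = "\<lambda>(m, n). (m, m + n)" and i = "\<lambda>(m, k). (m, k - m)",
          THEN iffD2, OF _ _ _ _ _ refl G])
       (auto simp: D_def A_def)
  \<comment> \<open>The map from \<open>(m, n)\<close> to \<open>(m + n, -n)\<close> preserves
    \<open>D\<close> and also produces the monomial \<open>x^m v^n\<close>, so all three series can
    be compared term by term.\<close>
  have H': "((\<lambda>(m, n). x powi (m + n) * u powi (-n) * (f (m + n) * f (-n))) has_sum
      lambertL Q x * lambertL Q u - (lambertL Q v - lambertV Q v)) D"
    by (rule has_sum_reindex_bij_witness[where j = "\<lambda>(m, n). (m + n, -n)" and i = "\<lambda>(k, l). (k + l, -l)",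
          THEN iffD2, OF _ _ _ _ _ refl H])
       (auto simp: D_def A_def)
  have "((\<lambda>(m, n). x powi m * v powi n * (f m * f n)) has_sum
      (lambertL Q u * lambertL Q v - lambertV Q x) + - (lambertL Q x * lambertL Q u - (lambertL Q v - lambertV Q v))) D"
  proof (rule has_sum_cong[THEN iffD1, rotated, OF has_sum_add[OF G' has_sum_uminusI[OF H']]])
    fix p assume "p \<in> D"
    then obtain m n where p: "p = (m, n)" and mn: "m \<noteq> 0" "n \<noteq> 0" "m + n \<noteq> 0"
      by (auto simp: D_def A_def)
    have ff: "f m * f n = f (m + n) * (f m - f (-n))"
    proof -
      have "Q powi m \<noteq> 1" "Q powi n \<noteq> 1" "Q powi m * Q powi n \<noteq> 1"
        using power_int_neq_1[OF mn(1)] power_int_neq_1[OF mn(2)] power_int_neq_1[OF mn(3)] Q0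
        by (simp_all add: power_int_add)
      then have "f m * f n = f (m + n) * (f m - (1 - f n))"
        using Q0 by (simp add: f_def power_int_add divide_simps) (simp add: algebra_simps)
      moreover have "f (-n) = 1 - f n" using fm mn by (simp add: A_def)
      ultimately show ?thesis by simp
    qed
    have eq: "u powi m * v powi (m + n) = x powi m * v powi n"
      "x powi (m + n) * u powi (-n) = x powi m * v powi n"
      using u0 v0 by (simp_all add: x_def power_int_mult_distrib power_int_add power_int_minus field_simps)
    show "(case p of (m, n) \<Rightarrow> u powi m * v powi (m + n) * (f m * f (m + n))) +
        - (case p of (m, n) \<Rightarrow> x powi (m + n) * u powi (-n) * (f (m + n) * f (-n))) =
        (case p of (m, n) \<Rightarrow> x powi m * v powi n * (f m * f n))"
      unfolding p prod.case eq ff by (simp add: algebra_simps)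
  qed
  from has_sum_unique[OF F this] show ?thesis
    by (simp add: x_def algebra_simps)
qed

end

section \<open>Eisenstein series of weight one at division points\<close>

lemma bounded_periodic:
  fixes g :: "int \<Rightarrow> complex" and N :: nat
  assumes N: "N > 0" and per: "\<And>k. g (k + int N) = g k"
  shows "\<exists>C. \<forall>n. norm (g (int n)) \<le> C"
proof (intro exI allI)
  fix n
  show "norm (g (int n)) \<le> (\<Sum>b<N. norm (g (int b)))"
  proof (induction n rule: less_induct)
    case (less n)
    show ?case
    proof (cases "n < N")
      case True
      then show ?thesis by (intro member_le_sum) auto
    next
      case False
      then show ?thesis using less[of "n - N"] per[of "int (n - N)"] N
        by (simp add: of_nat_diff)
    qed
  qed
qed

lemma summable_lambert_terms:
  fixes q :: complex
  assumes q: "norm q < 1" and "b \<ge> 1" "N > 0"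
  shows "summable (\<lambda>k. norm (q ^ (b * Suc k) / (1 - q ^ (N * Suc k))))"
proof (rule summable_comparison_test')
  have "summable (\<lambda>k. norm q ^ k)" using q by (simp add: summable_geometric)
  then show "summable (\<lambda>k. norm q ^ k * (1 / (1 - norm q)))" by (rule summable_mult2)
  fix k :: nat
  have b: "k \<le> b * Suc k" using assms(2) by (induction b) auto
  have N: "1 \<le> N * Suc k" using assms(3) by simp
  have "norm q ^ (N * Suc k) \<le> norm q ^ 1"
    using N q by (intro power_decreasing) auto
  moreover have "1 - norm (q ^ (N * Suc k)) \<le> norm (1 - q ^ (N * Suc k))"
    using norm_triangle_ineq2[of 1 "q ^ (N * Suc k)"] by simp
  ultimately have "1 - norm q \<le> norm (1 - q ^ (N * Suc k))"
    unfolding norm_power by simp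
  then have "norm q ^ (b * Suc k) / norm (1 - q ^ (N * Suc k)) \<le> norm q ^ k / (1 - norm q)"
    using q b by (intro frac_le power_decreasing) auto
  then show "norm (norm (q ^ (b * Suc k) / (1 - q ^ (N * Suc k)))) \<le> norm q ^ k * (1 / (1 - norm q))"
    by (simp add: norm_divide norm_power del: mult_Suc_right)
qed

text \<open>A shift by \<open>N\<close> multiplies the terms by \<open>z ^ N\<close>, so the series
  is a geometric series of periods.\<close>

lemma sums_periodic_power:
  fixes g :: "int \<Rightarrow> complex" and N :: nat
  assumes N: "N > 0" and per: "\<And>k. g (k + int N) = g k" and z: "norm z < 1"
  shows "(\<lambda>n. g (int (Suc n)) * z ^ Suc n) sums ((\<Sum>b=1..N. g (int b) * z ^ b) / (1 - z ^ N))"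
    and "summable (\<lambda>n. norm (g (int (Suc n)) * z ^ Suc n))"
proof -
  define f where "f = (\<lambda>n. g (int (Suc n)) * z ^ Suc n)"
  have shift: "f (n + N) = z ^ N * f n" for n
    using per[of "int (Suc n)"] by (simp add: f_def power_add algebra_simps)
  obtain C where gC: "\<And>n. norm (g (int (Suc n))) \<le> C"
    using bounded_periodic[of N g] N per by blast
  have "summable (\<lambda>n. C * norm z ^ Suc n)"
    using z by (intro summable_mult) (subst summable_Suc_iff, simp add: summable_geometric)
  then have abs: "summable (\<lambda>n. norm (f n))"
  proof (rule summable_comparison_test')
    show "norm (norm (f n)) \<le> C * norm z ^ Suc n" if "n \<ge> 0" for n
      unfolding f_def norm_mult norm_power real_norm_def abs_mult power_abs abs_norm_cancel
      by (intro mult_right_mono gC zero_le_power norm_ge_zero)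
  qed
  then show "summable (\<lambda>n. norm (g (int (Suc n)) * z ^ Suc n))" by (simp add: f_def)
  have sm: "summable f" using abs by (rule summable_norm_cancel)
  have "(\<Sum>n. f (n + N)) = z ^ N * suminf f"
    unfolding shift by (rule suminf_mult[OF sm])
  then have "suminf f * (1 - z ^ N) = sum f {..<N}"
    using suminf_split_initial_segment[OF sm, of N] by (simp add: algebra_simps)
  moreover have "sum f {..<N} = (\<Sum>b=1..N. g (int b) * z ^ b)"
    unfolding f_def by (rule sum.reindex_bij_witness[of _ "\<lambda>k. k - 1" Suc]) auto
  moreover have "z ^ N \<noteq> 1"
  proof
    assume "z ^ N = 1"
    then have "norm z ^ N = 1" by (simp flip: norm_power)
    then show False using z N power_less_one_iff[of "norm z" N] by simp
  qed
  ultimately have "suminf f = (\<Sum>b=1..N. g (int b) * z ^ b) / (1 - z ^ N)"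
    by (simp add: field_simps)
  then show "(\<lambda>n. g (int (Suc n)) * z ^ Suc n) sums ((\<Sum>b=1..N. g (int b) * z ^ b) / (1 - z ^ N))"
    using summable_sums[OF sm] by (simp add: f_def)
qed

text \<open>Both sides are iterated sums of the absolutely convergent double series of
  \<open>g n * q^(n k)\<close> over positive \<open>n\<close> and \<open>k\<close>. Summing over
  \<open>k\<close> first gives the left side; summing over \<open>n\<close> first collects the
  residues modulo \<open>N\<close>.\<close>

lemma lambert_series_periodic:
  fixes g :: "int \<Rightarrow> complex" and N :: nat and q :: complex
  assumes N: "N > 0" and per: "\<And>k. g (k + int N) = g k" and q: "norm q < 1"
  shows "(\<Sum>n. g (int (Suc n)) * (q ^ Suc n / (1 - q ^ Suc n))) =
    (\<Sum>b=1..N. g (int b) * (\<Sum>k. q ^ (b * Suc k) / (1 - q ^ (N * Suc k))))"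
proof -
  have lt1: "norm (q ^ Suc n) < 1" for n
    using q power_less_one_iff[of "norm q" "Suc n"] by (simp add: norm_power del: power_Suc)
  obtain C where C: "\<And>n. norm (g (int (Suc n))) \<le> C"
    using bounded_periodic[of N g] N per by blast
  define F where "F = (\<lambda>(n, k). g (int (Suc n)) * q ^ (Suc n * Suc k))"
  have geo: "(\<lambda>n. norm (q ^ n)) summable_on UNIV"
    using q by (intro norm_summable_imp_summable_on) (simp add: norm_power summable_geometric)
  have "(\<lambda>(n, k). q ^ n * q ^ k) summable_on UNIV \<times> UNIV"
    by (rule has_sum_imp_summable[OF has_sum_product_abs[OF geo geo]])
  then have "(\<lambda>p. C * norm (case p of (n, k) \<Rightarrow> q ^ n * q ^ k)) summable_on UNIV \<times> UNIV"
    unfolding summable_on_iff_abs_summable_on_complex by (rule summable_on_cmult_right)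
  then have "(\<lambda>p. norm (F p)) summable_on UNIV \<times> UNIV"
  proof (rule Infinite_Sum.abs_summable_on_comparison_test')
    fix p :: "nat \<times> nat"
    obtain n k where p: "p = (n, k)" by force
    \<comment> \<open>Since \<open>(n + 1) (k + 1) >= n + k\<close>, a product of two geometric
      series is a majorant.\<close>
    have "norm q ^ (Suc n * Suc k) \<le> norm q ^ (n + k)"
      using q by (intro power_decreasing) auto
    then have "norm (g (int (Suc n))) * norm q ^ (Suc n * Suc k) \<le> C * norm q ^ (n + k)"
      using C by (intro mult_mono) (auto intro: order.trans[OF norm_ge_zero])
    then show "norm (F p) \<le> C * norm (case p of (n, k) \<Rightarrow> q ^ n * q ^ k)"
      by (simp add: p F_def norm_mult norm_power power_add del: mult_Suc mult_Suc_right of_nat_Suc)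
  qed
  then have "F summable_on UNIV \<times> UNIV" by (rule abs_summable_summable)
  then obtain S where S: "(F has_sum S) (UNIV \<times> UNIV)" by (auto simp: summable_on_def)
  have "((\<lambda>n. g (int (Suc n)) * (q ^ Suc n / (1 - q ^ Suc n))) has_sum S) UNIV"
  proof (rule has_sum_SigmaD[OF S])
    fix n :: nat
    have "((\<lambda>k. (q ^ Suc n) ^ Suc k) has_sum (q ^ Suc n / (1 - q ^ Suc n))) UNIV"
    proof (rule norm_summable_imp_has_sum)
      show "summable (\<lambda>k. norm ((q ^ Suc n) ^ Suc k))"
        unfolding norm_power[of "q ^ Suc n"] summable_Suc_iff[of "\<lambda>k. norm (q ^ Suc n) ^ k"]
        using lt1[of n] by (intro summable_geometric) simp
      show "(\<lambda>k. (q ^ Suc n) ^ Suc k) sums (q ^ Suc n / (1 - q ^ Suc n))"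
        using sums_mult[OF geometric_sums[OF lt1[of n]], of "q ^ Suc n"] by simp
    qed
    then show "((\<lambda>k. F (n, k)) has_sum g (int (Suc n)) * (q ^ Suc n / (1 - q ^ Suc n))) UNIV"
      unfolding F_def prod.case power_mult by (rule has_sum_cmult_right)
  qed
  then have 1: "(\<Sum>n. g (int (Suc n)) * (q ^ Suc n / (1 - q ^ Suc n))) = S"
    by (intro sums_unique[symmetric] has_sum_imp_sums)
  have "((\<lambda>k. \<Sum>b=1..N. g (int b) * (q ^ (b * Suc k) / (1 - q ^ (N * Suc k)))) has_sum S) UNIV"
  proof (rule has_sum_SigmaD)
    show "((\<lambda>(k, n). F (n, k)) has_sum S) (UNIV \<times> UNIV)"
      using S by (subst (asm) has_sum_swap)
    fix k :: nat
    have "((\<lambda>n. g (int (Suc n)) * (q ^ Suc k) ^ Suc n) has_sum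
        ((\<Sum>b=1..N. g (int b) * (q ^ Suc k) ^ b) / (1 - (q ^ Suc k) ^ N))) UNIV"
      by (rule norm_summable_imp_has_sum[OF sums_periodic_power(2,1)[where g = g and z = "q ^ Suc k", OF N per lt1]])
    then show "((\<lambda>n. case (k, n) of (k, n) \<Rightarrow> F (n, k)) has_sum
        (\<Sum>b=1..N. g (int b) * (q ^ (b * Suc k) / (1 - q ^ (N * Suc k))))) UNIV"
      unfolding F_def prod.case power_mult[symmetric] sum_divide_distrib by (simp only: mult.commute times_divide_eq_right)
  qed
  then have "(\<Sum>k. \<Sum>b=1..N. g (int b) * (q ^ (b * Suc k) / (1 - q ^ (N * Suc k)))) = S"
    by (intro sums_unique[symmetric] has_sum_imp_sums)
  also have "(\<Sum>k. \<Sum>b=1..N. g (int b) * (q ^ (b * Suc k) / (1 - q ^ (N * Suc k)))) =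
      (\<Sum>b=1..N. \<Sum>k. g (int b) * (q ^ (b * Suc k) / (1 - q ^ (N * Suc k))))"
    by (intro suminf_sum summable_mult summable_norm_cancel[OF summable_lambert_terms] q N) auto
  also have "\<dots> = (\<Sum>b=1..N. g (int b) * (\<Sum>k. q ^ (b * Suc k) / (1 - q ^ (N * Suc k))))"
    by (intro sum.cong refl suminf_mult summable_norm_cancel[OF summable_lambert_terms] q N) auto
  finally show ?thesis using 1 by simp
qed

text \<open>Positive indices give the first series directly. At \<open>m = -k\<close>, multiplying
  numerator and denominator by \<open>q^(N k)\<close> turns the numerator into
  \<open>q^((N - b) k)\<close> and reverses the sign. This links the bilateral series, which obey
  the product formula, with the one-sided ones in \<open>E1\<close>.\<close>

lemma lambertL_eq_suminf:
  fixes q :: complex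
  assumes q: "q \<noteq> 0" "norm q < 1" and b: "1 \<le> b" "b < N"
  shows "lambertL (q ^ N) (q ^ b) =
    (\<Sum>k. q ^ (b * Suc k) / (1 - q ^ (N * Suc k))) - (\<Sum>k. q ^ ((N - b) * Suc k) / (1 - q ^ (N * Suc k)))"
proof -
  define A where "A = (\<lambda>c k. q ^ (c * Suc k) / (1 - q ^ (N * Suc k)))"
  have A: "(A c has_sum suminf (A c)) UNIV" if "c \<ge> 1" for c
    unfolding A_def using summable_lambert_terms[OF q(2) that, of N] b
    by (intro norm_summable_imp_has_sum summable_sums summable_norm_cancel[OF summable_lambert_terms[OF q(2) that]]) auto
  let ?f = "\<lambda>m. (q ^ b) powi m / (1 - (q ^ N) powi m)"
  have "(?f has_sum suminf (A b)) {0<..}"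
    by (rule has_sum_reindex_bij_witness[where j = "\<lambda>m. nat m - 1" and i = "\<lambda>k. int (Suc k)",
          THEN iffD2, OF _ _ _ _ _ refl A[OF b(1)]])
       (auto simp: A_def power_int_def simp flip: power_mult simp del: mult_Suc_right)
  moreover have "(?f has_sum - suminf (A (N - b))) {..<0}"
  proof -
    have k: "?f (- int (Suc k)) = - A (N - b) k" for k
    proof -
      define X Y where "X = (q ^ b) ^ Suc k" and "Y = (q ^ N) ^ Suc k"
      have X: "X \<noteq> 0" using q(1) by (simp add: X_def)
      have "norm (q ^ (N * Suc k)) < 1"
        using q(2) b power_less_one_iff[of "norm q" "N * Suc k"] by (simp add: norm_power del: mult_Suc_right)
      then have Y: "Y \<noteq> 1" "Y \<noteq> 0" using q(1) by (auto simp: Y_def power_mult[symmetric] simp del: mult_Suc_right power_Suc)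
      have "q ^ ((N - b) * Suc k) * X = Y"
        unfolding X_def Y_def power_mult[symmetric] power_add[symmetric] distrib_right[symmetric]
        using b by simp
      then have YX: "q ^ ((N - b) * Suc k) = Y / X" using X by (simp add: field_simps)
      have "A (N - b) k = Y / X / (1 - Y)"
        unfolding A_def YX by (simp add: Y_def power_mult del: mult_Suc_right power_Suc)
      moreover have "?f (- int (Suc k)) = inverse X / (1 - inverse Y)"
        unfolding power_int_minus power_int_of_nat X_def Y_def ..
      moreover have "inverse X / (1 - inverse Y) = - (Y / X / (1 - Y))"
      proof -
        have "1 - inverse Y = - ((1 - Y) / Y)" using Y by (simp add: diff_divide_distrib inverse_eq_divide)
        moreover have "inverse X / - (W / Y) = - (Y / X / W)" for W
          by (simp add: divide_inverse mult_ac)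
        ultimately show ?thesis by (simp only:)
      qed
      ultimately show ?thesis by (simp only:)
    qed
    show ?thesis
      by (rule has_sum_reindex_bij_witness[where j = "\<lambda>m. nat (-m) - 1" and i = "\<lambda>k. - int (Suc k)"
            and h = "\<lambda>k. - A (N - b) k", THEN iffD2, OF _ _ _ _ _ refl has_sum_uminusI[OF A]])
         (use b in \<open>auto simp: k[symmetric] simp del: of_nat_Suc\<close>)
  qed
  ultimately have "(?f has_sum suminf (A b) + - suminf (A (N - b))) ({0<..} \<union> {..<0})"
    by (rule has_sum_Un_disjoint) auto
  moreover have "{0<..} \<union> {..<0} = -{0::int}" by auto
  ultimately show ?thesis
    unfolding lambertL_def A_def by (simp add: infsumI)
qed

section \<open>Zeta and Weierstrass values at division points\<close>

definition lambert_s :: "nat \<Rightarrow> complex \<Rightarrow> nat \<Rightarrow> complex" where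
  "lambert_s N q b = lambertL (q ^ N) (q ^ b) + (1/2 - of_nat b / of_nat N)"

text \<open>
  The combination \<open>lambert_s\<^sup>2 + 2 lambert_U\<close> is a normalised value of \<open>\<wp>\<close> at the division point \<open>b\<close>, so that
  \<open>lambert_s_U_relation\<close> is \<open>(\<zeta> x + \<zeta> y + \<zeta> z)\<^sup>2 = \<wp> x + \<wp> y + \<wp> z\<close>.
\<close>
definition lambert_U :: "nat \<Rightarrow> complex \<Rightarrow> nat \<Rightarrow> complex" where
  "lambert_U N q b = (let l = 1/2 - of_nat b / of_nat N in
     lambertV (q ^ N) (q ^ b) - (l + 1/2) * lambert_s N q b + (l\<^sup>2 + l) / 2 + 1/24)"

lemma norm_power_strict_antimono:
  fixes q :: complex
  assumes "q \<noteq> 0" "norm q < 1" "b < N"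
  shows "norm (q ^ N) < norm (q ^ b)"
  using assms power_strict_decreasing[of b N "norm q"] by (simp add: norm_power)

lemma lambert_s_U_relation:
  fixes q :: complex
  assumes q: "q \<noteq> 0" "norm q < 1" and ab: "1 \<le> a" "1 \<le> b" "a + b < N"
  shows "lambert_s N q (a + b) * (lambert_s N q a + lambert_s N q b) - lambert_s N q a * lambert_s N q b
    + lambert_U N q a + lambert_U N q b + lambert_U N q (a + b) = 0"
proof -
  define A B where "A = 1/2 - of_nat a / (of_nat N :: complex)" and "B = 1/2 - of_nat b / (of_nat N :: complex)"
  have C: "1/2 - of_nat (a + b) / (of_nat N :: complex) = A + B - 1/2"
    by (simp add: A_def B_def add_divide_distrib)
  \<comment> \<open>Purely algebraic: after expansion \<open>x\<close>, \<open>y\<close>,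
    \<open>z\<close> have the linear coefficients \<open>-1\<close>, \<open>-1\<close>,
    \<open>0\<close> of the product formula, and the constant terms leave
    \<open>3/24 - (1/2)^2 / 2 = 0\<close>. This fixes the \<open>1/24\<close> in
    \<open>lambert_U\<close>.\<close>
  have key: "(z + (A + B - 1/2)) * (x + A + (y + B)) - (x + A) * (y + B)
      + (vx - (A + 1/2) * (x + A) + (A\<^sup>2 + A) / 2 + 1/24) + (vy - (B + 1/2) * (y + B) + (B\<^sup>2 + B) / 2 + 1/24)
      + (vz - (A + B - 1/2 + 1/2) * (z + (A + B - 1/2)) + ((A + B - 1/2)\<^sup>2 + (A + B - 1/2)) / 2 + 1/24) = 0"
    (is "?e = 0") if "z * (x + y) - x * y = x + y - vx - vy - vz" for x y z vx vy vz :: complex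
  proof -
    have "?e = (z * (x + y) - x * y) - (x + y - vx - vy - vz)"
      by (simp add: field_simps power2_eq_square)
    then show ?thesis using that by simp
  qed
  have lt1: "norm (q ^ c) < 1" if "c \<ge> 1" for c
    using norm_power_strict_antimono[OF q, of 0 c] that by simp
  have "lambertL (q ^ N) (q ^ a * q ^ b) * (lambertL (q ^ N) (q ^ a) + lambertL (q ^ N) (q ^ b)) -
      lambertL (q ^ N) (q ^ a) * lambertL (q ^ N) (q ^ b) =
    lambertL (q ^ N) (q ^ a) + lambertL (q ^ N) (q ^ b) - lambertV (q ^ N) (q ^ a) -
      lambertV (q ^ N) (q ^ b) - lambertV (q ^ N) (q ^ a * q ^ b)"
    unfolding power_add[symmetric]
    by (rule lambert_product[where u = "q ^ a" and v = "q ^ b", unfolded power_add[symmetric]])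
       (use q ab in \<open>auto intro!: norm_power_strict_antimono lt1\<close>)
  then show ?thesis
    unfolding lambert_U_def Let_def lambert_s_def C A_def[symmetric] B_def[symmetric] power_add
    by (rule key)
qed

text \<open>Apply \<open>lambert_reflect\<close> with parameter \<open>q ^ N\<close> at
  \<open>q ^ b\<close>; the constant \<open>1/2 - b/N\<close> changes sign as well. For
  \<open>N = 17\<close> this leaves eight independent indices, \<open>b = 1\<close> to
  \<open>8\<close>.\<close>

lemma lambert_s_U_reflect:
  fixes q :: complex
  assumes q: "q \<noteq> 0" "norm q < 1" and b: "1 \<le> b" "b < N"
  shows "lambert_s N q (N - b) = - lambert_s N q b" "lambert_U N q (N - b) = lambert_U N q b"
proof -
  have "q ^ (N - b) = q ^ N / q ^ b" using b q by (simp add: power_diff)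
  moreover have "norm (q ^ N) < norm (q ^ b)" "norm (q ^ b) < 1" "norm (q ^ N) < 1"
    using b norm_power_strict_antimono[OF q, of b N] norm_power_strict_antimono[OF q, of 0] by auto
  ultimately have LV: "lambertL (q ^ N) (q ^ (N - b)) = - lambertL (q ^ N) (q ^ b)"
    "lambertV (q ^ N) (q ^ (N - b)) = lambertV (q ^ N) (q ^ b) - lambertL (q ^ N) (q ^ b)"
    using q by (simp_all add: lambert_reflect)
  have l: "1/2 - of_nat (N - b) / (of_nat N :: complex) = - (1/2 - of_nat b / of_nat N)"
    using b by (simp add: of_nat_diff field_simps)
  show s: "lambert_s N q (N - b) = - lambert_s N q b"
    unfolding lambert_s_def LV l by simp
  show "lambert_U N q (N - b) = lambert_U N q b"
    unfolding lambert_U_def Let_def s LV l unfolding lambert_s_def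
    by (simp add: algebra_simps power2_eq_square add_divide_distrib diff_divide_distrib)
qed

section \<open>From division values to \<open>E1\<close> for odd characters\<close>

lemma sum_odd_periodic_reflect:
  fixes g :: "int \<Rightarrow> complex" and h :: "nat \<Rightarrow> complex"
  assumes "\<And>k. g (k + int N) = g k" "\<And>k. g (- k) = - g k"
  shows "(\<Sum>b=1..<N. g (int b) * h (N - b)) = - (\<Sum>b=1..<N. g (int b) * h b)"
proof -
  have "(\<Sum>b=1..<N. g (int b) * h (N - b)) = (\<Sum>b=1..<N. - (g (int b) * h b))"
  proof (rule sum.reindex_bij_witness[of _ "\<lambda>b. N - b" "\<lambda>b. N - b"])
    fix b assume "b \<in> {1..<N}"
    then have "g (int (N - b)) = - g (int b)"
      using assms(1)[of "- int b"] assms(2)[of "int b"] by (simp add: of_nat_diff algebra_simps)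
    then show "- (g (int (N - b)) * h (N - b)) = g (int b) * h (N - b)" by simp
  qed auto
  then show ?thesis by (simp add: sum_negf)
qed

text \<open>An odd \<open>chi\<close> sums to zero over a period, so the weight \<open>- b/N\<close>
  in the L-value may be replaced by \<open>1/2 - b/N\<close>, the constant term of
  \<open>lambert_s\<close>. Oddness also folds the two halves of \<open>lambertL\<close> into twice
  a one-sided Lambert series, matching the factor 2 in \<open>E1\<close>.\<close>

lemma odd_character_L_E1:
  fixes chi :: "int \<Rightarrow> complex" and N :: nat
  assumes N: "N > 0" and chi: "chi \<in> odd_characters (int N)"
  shows "Dirichlet_L 0 chi = (\<Sum>b=1..<N. chi (int b) * (1/2 - of_nat b / of_nat N))" (is ?L)
    and "Im \<tau> > 0 \<Longrightarrow> Dirichlet_L 0 chi \<noteq> 0 \<Longrightarrow>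
      Dirichlet_L 0 chi * E1 chi \<tau> =
        (\<Sum>b=1..<N. chi (int b) * lambert_s N (exp (2 * of_real pi * \<i> * \<tau>)) b)"
proof -
  have per: "chi (k + int N) = chi k" and mult: "chi (k * l) = chi k * chi l" and m1: "chi (-1) = -1" for k l
    using chi by (auto simp: odd_characters_def dirichlet_character_def)
  have odd: "chi (-k) = - chi k" for k using mult[of "-1" k] m1 by simp
  have "chi 0 = 0" using odd[of 0] by simp
  then have chiN: "chi (int N) = 0" using per[of 0] by simp
  have split: "(\<Sum>k=1..N. chi (int k) * h k) = (\<Sum>k=1..<N. chi (int k) * h k)" for h
    using N chiN by (simp add: atLeastLessThanSuc_atLeastAtMost[symmetric])
  note refl = sum_odd_periodic_reflect[of chi N, OF per odd]
  have zero: "(\<Sum>k=1..<N. chi (int k)) = 0" 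
  proof -
    have "(\<Sum>k=1..<N. chi (int k)) + (\<Sum>k=1..<N. chi (int k)) = 0"
      using refl[of "\<lambda>_. 1"] unfolding eq_neg_iff_add_eq_0 mult_1_right .
    then show ?thesis unfolding mult_2[symmetric] by simp
  qed
  have "Dirichlet_L 0 chi = - (\<Sum>k=1..N. of_nat k * chi (int k)) / of_nat N"
    by (rule Dirichlet_L_0_periodic[of N chi, OF N per]) (rule trans[OF split[of "\<lambda>_. 1", unfolded mult_1_right] zero])
  also have "(\<Sum>k=1..N. of_nat k * chi (int k)) = (\<Sum>k=1..<N. chi (int k) * of_nat k)"
    using split[of of_nat] by (simp add: mult.commute)
  also have "- \<dots> / of_nat N = (\<Sum>k=1..<N. chi (int k)) / 2 - (\<Sum>k=1..<N. chi (int k) * of_nat k) / of_nat N"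
    unfolding zero by simp
  also have "\<dots> = (\<Sum>b=1..<N. chi (int b) * (1/2 - of_nat b / of_nat N))"
    by (simp add: right_diff_distrib sum_subtractf sum_divide_distrib)
  finally show L: ?L .
  assume tau: "Im \<tau> > 0" and nz: "Dirichlet_L 0 chi \<noteq> 0"
  define q where "q = exp (2 * of_real pi * \<i> * \<tau>)"
  have q: "q \<noteq> 0" "norm q < 1" using tau by (simp_all add: q_def)
  define A where "A = (\<lambda>c. \<Sum>k. q ^ (c * Suc k) / (1 - q ^ (N * Suc k)))"
  have "(\<Sum>n. chi (int (Suc n)) * (q ^ Suc n / (1 - q ^ Suc n))) = (\<Sum>b=1..N. chi (int b) * A b)"
    unfolding A_def by (rule lambert_series_periodic[of N chi, OF N per q(2)])
  also have "\<dots> = (\<Sum>b=1..<N. chi (int b) * A b)" by (rule split)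
  finally have E: "E1 chi \<tau> = 1 + 2 / Dirichlet_L 0 chi * (\<Sum>b=1..<N. chi (int b) * A b)"
    unfolding E1_def Let_def q_def[symmetric] by simp
  have "(\<Sum>b=1..<N. chi (int b) * lambertL (q ^ N) (q ^ b)) = (\<Sum>b=1..<N. chi (int b) * A b - chi (int b) * A (N - b))"
  proof (rule sum.cong)
    fix b assume "b \<in> {1..<N}"
    then have "lambertL (q ^ N) (q ^ b) = A b - A (N - b)"
      unfolding A_def by (intro lambertL_eq_suminf[OF q]) auto
    then show "chi (int b) * lambertL (q ^ N) (q ^ b) = chi (int b) * A b - chi (int b) * A (N - b)"
      by (simp add: right_diff_distrib)
  qed simp
  also have "\<dots> = 2 * (\<Sum>b=1..<N. chi (int b) * A b)"
    unfolding sum_subtractf refl[of A] by simp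
  finally have "(\<Sum>b=1..<N. chi (int b) * lambert_s N q b) =
      2 * (\<Sum>b=1..<N. chi (int b) * A b) + Dirichlet_L 0 chi"
    unfolding lambert_s_def L by (simp add: distrib_left sum.distrib)
  then show "Dirichlet_L 0 chi * E1 chi \<tau> = (\<Sum>b=1..<N. chi (int b) * lambert_s N (exp (2 * of_real pi * \<i> * \<tau>)) b)"
    unfolding q_def[symmetric] E using nz by (simp add: field_simps)
qed

section \<open>Odd characters modulo 17\<close>

lemma coprime_17_iff: "coprime (m::int) 17 \<longleftrightarrow> \<not> 17 dvd m"
proof
  have "prime (17::int)" by simp
  then show "\<not> 17 dvd m \<Longrightarrow> coprime m 17"
    using prime_imp_coprime[of 17 m] by (simp add: coprime_commute)
  show "coprime m 17 \<Longrightarrow> \<not> 17 dvd m"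
    using coprime_common_divisor[of m 17 17] by auto
qed

lemma power_3_mod_17_surj:
  assumes "\<not> 17 dvd (m::int)"
  shows "\<exists>k<16. m mod 17 = 3 ^ k mod 17"
proof -
  have ex: "\<exists>k<16. m mod 17 = 3 ^ k mod 17" if "m mod 17 = 3 ^ j mod 17" "j < 16" for j :: nat
    using that by blast
  have "m mod 17 \<noteq> 0" "0 \<le> m mod 17" "m mod 17 < 17" using assms by (simp_all add: dvd_eq_mod_eq_0)
  \<comment> \<open>The residues are listed in the order \<open>3 ^ 0\<close>, \<open>3 ^ 1\<close>,
    ..., \<open>3 ^ 15\<close> modulo 17, so position \<open>k\<close> has witness
    \<open>k\<close>.\<close>
  then have "m mod 17 = 1 \<or> m mod 17 = 3 \<or> m mod 17 = 9 \<or> m mod 17 = 10 \<or> m mod 17 = 13 \<or> m mod 17 = 5 \<or> m mod 17 = 15 \<or> m mod 17 = 11 \<or> m mod 17 = 16 \<or> m mod 17 = 14 \<or> m mod 17 = 8 \<or> m mod 17 = 7 \<or> m mod 17 = 4 \<or> m mod 17 = 12 \<or> m mod 17 = 2 \<or> m mod 17 = 6"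
    by arith
  then show ?thesis
    apply (elim disjE)
    subgoal by (rule ex[of 0]) simp_all
    subgoal by (rule ex[of 1]) simp_all
    subgoal by (rule ex[of 2]) simp_all
    subgoal by (rule ex[of 3]) simp_all
    subgoal by (rule ex[of 4]) simp_all
    subgoal by (rule ex[of 5]) simp_all
    subgoal by (rule ex[of 6]) simp_all
    subgoal by (rule ex[of 7]) simp_all
    subgoal by (rule ex[of 8]) simp_all
    subgoal by (rule ex[of 9]) simp_all
    subgoal by (rule ex[of 10]) simp_all
    subgoal by (rule ex[of 11]) simp_all
    subgoal by (rule ex[of 12]) simp_all
    subgoal by (rule ex[of 13]) simp_all
    subgoal by (rule ex[of 14]) simp_all
    subgoal by (rule ex[of 15]) simp_all
    done
qed

text \<open>Exponents reduce modulo 16 because \<open>3 ^ 16\<close> is 1 modulo 17. The 16 reduced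
  exponents reach all 16 nonzero residues, so the map is injective by counting.\<close>

lemma power_3_mod_17_eqD:
  assumes "3 ^ k mod 17 = (3 ^ l mod 17 :: int)"
  shows "k mod 16 = l mod 16"
proof -
  have red: "3 ^ k mod 17 = (3 ^ (k mod 16) mod 17 :: int)" for k
  proof -
    have "(3::int) ^ k = (3 ^ 16) ^ (k div 16) * 3 ^ (k mod 16)"
      by (simp only: power_mult[symmetric] power_add[symmetric] mult_div_mod_eq)
    also have "\<dots> mod 17 = ((3 ^ 16 mod 17) ^ (k div 16) mod 17) * 3 ^ (k mod 16) mod 17"
      by (simp only: power_mod mod_mult_left_eq)
    finally show ?thesis by simp
  qed
  have "(\<lambda>k. 3 ^ k mod 17 :: int) ` {..<16} = {1..16}"
  proof (rule antisym)
    have "3 ^ k mod 17 \<in> {1..16::int}" for k :: nat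
    proof -
      have "\<not> (17::int) dvd 3 ^ k" using prime_dvd_power[of "17::int" 3 k] by auto
      then have "3 ^ k mod 17 \<noteq> (0::int)" by (simp add: dvd_eq_mod_eq_0)
      then show ?thesis using pos_mod_sign[of 17 "3 ^ k"] pos_mod_bound[of 17 "3 ^ k"] by auto
    qed
    then show "(\<lambda>k. 3 ^ k mod 17 :: int) ` {..<16} \<subseteq> {1..16}" by blast
    show "{1..16} \<subseteq> (\<lambda>k. 3 ^ k mod 17 :: int) ` {..<16}"
    proof
      fix r :: int assume r: "r \<in> {1..16}"
      then have "\<not> 17 dvd r" using zdvd_imp_le[of 17 r] by auto
      then show "r \<in> (\<lambda>k. 3 ^ k mod 17) ` {..<16}"
        using power_3_mod_17_surj[of r] r by auto
    qed
  qed
  then have "inj_on (\<lambda>k. 3 ^ k mod 17 :: int) {..<16}"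
    by (intro eq_card_imp_inj_on) simp_all
  then show ?thesis
    using assms unfolding red[of k] red[of l] by (auto dest: inj_onD)
qed

lemma odd_character_17_power:
  assumes chi: "chi \<in> odd_characters 17" and "m mod 17 = 3 ^ k mod 17"
  shows "chi m = chi 3 ^ k"
proof -
  have D: "dirichlet_character 17 chi" using chi by (simp add: odd_characters_def)
  have mult: "chi (x * y) = chi x * chi y" and nz: "chi x \<noteq> 0 \<longleftrightarrow> coprime x 17" for x y
    using D by (auto simp: dirichlet_character_def)
  have "chi 1 = chi 1 * chi 1" "chi 1 \<noteq> 0" using mult[of 1 1] nz[of 1] by simp_all
  then have one: "chi 1 = 1" by simp
  have "chi (3 ^ k) = chi 3 ^ k" by (induction k) (simp_all add: mult one)
  then show ?thesis
    using dirichlet_character_mod[OF D, of m] dirichlet_character_mod[OF D, of "3 ^ k"] assms(2) by simp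
qed

text \<open>A character is determined by its value at the primitive root 3, and since
  \<open>3 ^ 8\<close> is -1 modulo 17, oddness amounts to \<open>w ^ 8 = -1\<close>.\<close>

lemma odd_characters_17_bij: "bij_betw (\<lambda>chi. chi 3) (odd_characters 17) {w::complex. w ^ 8 = -1}"
proof (rule bij_betwI')
  fix chi psi assume chi: "chi \<in> odd_characters 17" and psi: "psi \<in> odd_characters 17"
  have zero: "f m = 0" if "f \<in> odd_characters 17" "17 dvd m" for f m
    using that by (auto simp: odd_characters_def dirichlet_character_def coprime_17_iff)
  have "chi m = psi m" if "chi 3 = psi 3" for m
  proof (cases "17 dvd m")
    case True
    then show ?thesis using zero[OF chi] zero[OF psi] by simp
  next
    case False
    then obtain k where "m mod 17 = 3 ^ k mod 17" using power_3_mod_17_surj by blast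
    then show ?thesis using odd_character_17_power[OF chi] odd_character_17_power[OF psi] that by simp
  qed
  then show "(chi 3 = psi 3) = (chi = psi)" by auto
next
  fix chi assume chi: "chi \<in> odd_characters 17"
  have "chi (-1) = chi 3 ^ 8" by (rule odd_character_17_power[OF chi]) simp
  then show "chi 3 \<in> {w. w ^ 8 = -1}" using chi by (simp add: odd_characters_def)
next
  fix w :: complex assume "w \<in> {w. w ^ 8 = -1}"
  then have w8: "w ^ 8 = -1" by simp
  have w16: "w ^ 16 = 1" using w8 power_mult[of w 8 2] by simp
  have cong: "w ^ k = w ^ l" if "3 ^ k mod 17 = (3 ^ l mod 17 :: int)" for k l
  proof -
    have red: "w ^ k = w ^ (k mod 16)" for k
    proof -
      have "w ^ k = (w ^ 16) ^ (k div 16) * w ^ (k mod 16)"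
        by (simp only: power_mult[symmetric] power_add[symmetric] mult_div_mod_eq)
      then show ?thesis by (simp add: w16)
    qed
    show ?thesis using power_3_mod_17_eqD[OF that] red[of k] red[of l] by simp
  qed
  \<comment> \<open>Any discrete logarithm to base 3 will do: the choice depends only on
    \<open>m mod 17\<close>, which makes \<open>chi\<close> periodic, and by \<open>cong\<close> the
    value \<open>w ^ k\<close> is the same for every admissible exponent.\<close>
  define ind where "ind = (\<lambda>m::int. SOME k::nat. m mod 17 = 3 ^ k mod 17)"
  have ind: "m mod 17 = 3 ^ ind m mod 17" if "\<not> 17 dvd m" for m
    unfolding ind_def by (rule someI_ex) (use power_3_mod_17_surj[OF that] in blast)
  define chi where "chi = (\<lambda>m. if 17 dvd m then 0 else w ^ ind m)"
  have chi: "chi m = w ^ k" if "m mod 17 = 3 ^ k mod 17" for m k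
  proof -
    have "\<not> (17::int) dvd 3 ^ k" using prime_dvd_power[of "17::int" 3 k] by auto
    then have nd: "\<not> 17 dvd m" using that by (simp add: dvd_eq_mod_eq_0)
    then show ?thesis using cong[of "ind m" k] ind[OF nd] that by (simp add: chi_def)
  qed
  have w0: "w \<noteq> 0" using w8 by auto
  have "dirichlet_character 17 chi"
    unfolding dirichlet_character_def
  proof (intro conjI allI)
    show "chi (m + 17) = chi m" for m
      by (simp add: chi_def ind_def)
    show "chi (m * n) = chi m * chi n" for m n
    proof (cases "17 dvd m \<or> 17 dvd n")
      case True
      then show ?thesis by (auto simp: chi_def)
    next
      case False
      have "m * n mod 17 = (3 ^ ind m mod 17) * (3 ^ ind n mod 17) mod 17"
        using ind[of m] ind[of n] False by (simp only: mod_mult_eq[symmetric, of m n] de_Morgan_disj simp_thms)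
      then have "m * n mod 17 = 3 ^ (ind m + ind n) mod 17"
        by (simp add: mod_mult_eq power_add)
      from chi[OF this] show ?thesis using False by (simp add: chi_def power_add)
    qed
    show "(chi m \<noteq> 0) = coprime m 17" for m
      using w0 by (simp add: chi_def coprime_17_iff)
  qed
  moreover have "chi (-1) = -1" using chi[of "-1" 8] w8 by simp
  moreover have "chi 3 = w" using chi[of 3 1] by simp
  ultimately show "\<exists>chi\<in>odd_characters 17. w = chi 3" by (auto simp: odd_characters_def)
qed

text \<open>Multiplication by the primitive eighth root of unity \<open>z\<close> permutes the
  solutions and scales the sum by \<open>z ^ k\<close>, which is not 1.\<close>

lemma sum_roots_of_minus_one:
  assumes "\<not> 8 dvd k"
  shows "(\<Sum>w | (w::complex) ^ 8 = -1. w ^ k) = 0"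
proof -
  define z where "z = cis (2 * pi / 8)"
  have zz: "z ^ n = cis (real n * (2 * pi / 8))" for n
    unfolding z_def by (rule Complex.DeMoivre)
  have z8: "z ^ 8 = 1" by (subst zz) simp
  have zk: "z ^ k \<noteq> 1"
  proof
    assume "z ^ k = 1"
    then have "cos (real k * (2 * pi / 8)) = 1" unfolding zz by (metis cis.sel(1) one_complex.sel(1))
    then obtain n :: int where "real k * (2 * pi / 8) = of_int n * 2 * pi"
      unfolding cos_one_2pi_int by blast
    then have "real k = of_int (8 * n)" by (simp add: field_simps)
    then have "int k = 8 * n" by linarith
    then show False using assms by (metis dvd_triv_left int_dvd_int_iff of_nat_numeral)
  qed
  have z0: "z \<noteq> 0" using z8 by auto
  have "(\<Sum>w | w ^ 8 = -1. w ^ k) = (\<Sum>w | w ^ 8 = -1. (z * w) ^ k)"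
    by (rule sum.reindex_bij_witness[of _ "\<lambda>w. z * w" "\<lambda>w. w / z"])
       (use z0 z8 in \<open>auto simp: power_mult_distrib power_divide\<close>)
  also have "\<dots> = z ^ k * (\<Sum>w | w ^ 8 = -1. w ^ k)"
    by (simp add: power_mult_distrib sum_distrib_left)
  finally show ?thesis using zk by simp
qed

text \<open>Orthogonality over the odd characters alone. For \<open>m\<close> congruent to
  \<open>3 ^ k\<close> it is a power sum over the roots of \<open>w ^ 8 = -1\<close>; residues are
  separated only up to sign, hence the value \<open>-8\<close> at -1.\<close>

lemma sum_odd_characters_17:
  assumes "\<not> 17 dvd m"
  shows "(\<Sum>chi\<in>odd_characters 17. chi m) = (if m mod 17 = 1 then 8 else if m mod 17 = 16 then -8 else 0)"
proof -
  obtain k where k: "k < 16" "m mod 17 = 3 ^ k mod 17" using power_3_mod_17_surj[OF assms] by blast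
  have "(\<Sum>chi\<in>odd_characters 17. chi m) = (\<Sum>chi\<in>odd_characters 17. chi 3 ^ k)"
    by (intro sum.cong refl odd_character_17_power k)
  also have "\<dots> = (\<Sum>w | (w::complex) ^ 8 = -1. w ^ k)"
    by (rule sum.reindex_bij_betw[OF odd_characters_17_bij])
  also have "\<dots> = (if k = 0 then 8 else if k = 8 then -8 else 0)"
  proof -
    have card: "card {w::complex. w ^ 8 = -1} = 8" by (rule card_nth_roots) auto
    have "\<not> 8 dvd k" if "k \<noteq> 0" "k \<noteq> 8" using that k(1) by presburger
    then show ?thesis using sum_roots_of_minus_one[of k] card by auto
  qed
  also have "k = 0 \<longleftrightarrow> m mod 17 = 1"
  proof
    assume "m mod 17 = 1"
    then have "3 ^ k mod 17 = (3 ^ 0 mod 17 :: int)" using k(2) by simp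
    from power_3_mod_17_eqD[OF this] k(1) show "k = 0" by simp
  qed (simp add: k(2))
  also have "k = 8 \<longleftrightarrow> m mod 17 = 16"
  proof
    assume "m mod 17 = 16"
    then have "3 ^ k mod 17 = (3 ^ 8 mod 17 :: int)" using k(2) by simp
    from power_3_mod_17_eqD[OF this] k(1) show "k = 8" by simp
  qed (simp add: k(2))
  finally show ?thesis .
qed

section \<open>Nonvanishing of \<open>L(0, chi)\<close> modulo 17\<close>

lemma sum_1_17:
  "(\<Sum>b=1..<17::nat. f b) = f 1 + f 2 + f 3 + f 4 + f 5 + f 6 + f 7 + f 8 + f 9 + f 10
    + f 11 + f 12 + f 13 + f 14 + f 15 + f 16"
  by (simp add: numeral_eq_Suc)

text \<open>By the finite formula \<open>L(0, chi)\<close> is a rational polynomial in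
  \<open>w = chi 3\<close>. It is coprime to \<open>w ^ 8 + 1\<close>, which vanishes at
  \<open>w\<close>, so it cannot vanish there too.\<close>

lemma Dirichlet_L_0_odd_17_nonzero:
  assumes chi: "chi \<in> odd_characters 17"
  shows "Dirichlet_L 0 chi \<noteq> 0"
proof
  assume L0: "Dirichlet_L 0 chi = 0"
  define w where "w = chi 3"
  have pw: "chi m = w ^ k" if "m mod 17 = 3 ^ k mod 17" for m k
    unfolding w_def by (rule odd_character_17_power[OF chi that])
  have w8: "w ^ 8 = -1" using pw[of "-1" 8] chi by (simp add: odd_characters_def)
  have w: "w ^ (8 + j) = - (w ^ j)" for j by (simp add: power_add w8)
  have chis: "chi 1 = 1" "chi 3 = w" "chi 9 = w^2" "chi 10 = w^3" "chi 13 = w^4" "chi 5 = w^5" "chi 15 = w^6" "chi 11 = w^7"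
    "chi 16 = -1" "chi 14 = -w" "chi 8 = -(w^2)" "chi 7 = -(w^3)" "chi 4 = -(w^4)" "chi 12 = -(w^5)" "chi 2 = -(w^6)" "chi 6 = -(w^7)"
    using pw[of 1 0] pw[of 3 1] pw[of 9 2] pw[of 10 3] pw[of 13 4] pw[of 5 5] pw[of 15 6] pw[of 11 7]
      pw[of 16 8] pw[of 14 9] pw[of 8 10] pw[of 7 11] pw[of 4 12] pw[of 12 13] pw[of 2 14] pw[of 6 15]
      w[of 0] w[of 1] w[of 2] w[of 3] w[of 4] w[of 5] w[of 6] w[of 7] by simp_all
  have "Dirichlet_L 0 chi = (\<Sum>b=1..<17. chi (int b) * (1/2 - of_nat b / of_nat 17))"
    by (rule odd_character_L_E1(1)) (use chi in simp_all)
  then have "34 * Dirichlet_L 0 chi = (\<Sum>b=1..<17. chi (int b) * (17 - 2 * of_nat b))"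
    by (simp only: sum_distrib_left) (intro sum.cong refl, simp add: algebra_simps)
  \<comment> \<open>The coefficient of \<open>w ^ k\<close> is \<open>17 - 2 b\<close> for
    \<open>b\<close> the residue of \<open>3 ^ k\<close>; the factor 2 comes from pairing
    \<open>b\<close> with \<open>17 - b\<close>.\<close>
  then have "34 * Dirichlet_L 0 chi = 2 * (15 + 11*w - w^2 - 3*w^3 - 9*w^4 + 7*w^5 - 13*w^6 - 5*w^7)"
    unfolding sum_1_17 by (simp add: chis)
  then have p: "15 + 11*w - w^2 - 3*w^3 - 9*w^4 + 7*w^5 - 13*w^6 - 5*w^7 = 0"
    unfolding L0 mult_zero_right by (metis mult_eq_0_iff zero_neq_numeral)
  \<comment> \<open>a Bezout identity for this polynomial and \<open>w ^ 8 + 1\<close>\<close>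
  have "34 = (w^2 - w^3 + w^5 - w^7) * (15 + 11*w - w^2 - 3*w^3 - 9*w^4 + 7*w^5 - 13*w^6 - 5*w^7)
      - (w ^ 8 + 1) * (-34 + 15*w^2 - 4*w^3 - 12*w^4 + 13*w^5 + 5*w^6)"
    by Groebner_Basis.algebra
  then show False using p w8 by simp
qed

section \<open>Division values in terms of \<open>calE17\<close>\<close>

lemma calE17_mod_minus:
  shows "calE17 (a mod 17) \<tau> = calE17 a \<tau>" and "calE17 (- a) \<tau> = - calE17 a \<tau>"
proof -
  have "chi (a mod 17) = chi a" "chi (- a) = - chi a" if "chi \<in> odd_characters 17" for chi
  proof -
    have D: "dirichlet_character 17 chi" and m1: "chi (-1) = -1" using that by (auto simp: odd_characters_def)
    show "chi (a mod 17) = chi a" by (rule dirichlet_character_mod[OF D])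
    have "chi (-1 * a) = chi (-1) * chi a" using D unfolding dirichlet_character_def by blast
    then show "chi (- a) = - chi a" using m1 by simp
  qed
  then have eq: "chi (a mod 17) * E1 chi \<tau> = chi a * E1 chi \<tau>"
    "chi (- a) * E1 chi \<tau> = - (chi a * E1 chi \<tau>)" if "chi \<in> odd_characters 17" for chi
    using that by (metis, metis minus_mult_left)
  have "(\<Sum>chi\<in>odd_characters 17. chi (a mod 17) * E1 chi \<tau>) = (\<Sum>chi\<in>odd_characters 17. chi a * E1 chi \<tau>)"
    "(\<Sum>chi\<in>odd_characters 17. chi (- a) * E1 chi \<tau>) = (\<Sum>chi\<in>odd_characters 17. - (chi a * E1 chi \<tau>))"
    by (intro sum.cong refl eq; assumption)+
  then show "calE17 (a mod 17) \<tau> = calE17 a \<tau>" "calE17 (- a) \<tau> = - calE17 a \<tau>"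
    unfolding calE17_def by (simp_all add: sum_negf)
qed

text \<open>Weight the identities of \<open>odd_character_L_E1\<close> by \<open>chi a / 8\<close>
  and sum over the odd characters. The E-side becomes the stated sum of \<open>calE17\<close>
  values, and orthogonality leaves \<open>s c - s (17 - c) = 2 s c\<close> on the other
  side.\<close>

lemma lambert_s_eq_sum_calE17:
  assumes tau: "Im \<tau> > 0" and c: "c \<in> {1..<17}" and ac: "a * int c mod 17 = 1"
  shows "2 * lambert_s 17 (exp (2 * of_real pi * \<i> * \<tau>)) c =
    (\<Sum>b=1..<17. (1/2 - of_nat b / 17) * calE17 (a * int b mod 17) \<tau>)"
proof -
  define q where "q = exp (2 * of_real pi * \<i> * \<tau>)"
  define s where "s = lambert_s 17 q"
  define X where "X = odd_characters 17"
  have q: "q \<noteq> 0" "norm q < 1" using tau by (simp_all add: q_def)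
  have mult: "chi (k * l) = chi k * chi l" if "chi \<in> X" for chi k l
    using that by (auto simp: X_def odd_characters_def dirichlet_character_def)
  have E1: "(\<Sum>b=1..<17. (1/2 - of_nat b / 17) * chi (int b)) * E1 chi \<tau> = (\<Sum>b=1..<17. chi (int b) * s b)"
    if "chi \<in> X" for chi
  proof -
    have chi: "chi \<in> odd_characters (int 17)" using that by (simp add: X_def)
    show ?thesis
      using odd_character_L_E1[OF _ chi] tau Dirichlet_L_0_odd_17_nonzero[of chi] that
      by (simp add: s_def q_def X_def mult.commute)
  qed
  have orth: "(\<Sum>chi\<in>X. chi (a * int b)) = (if b = c then 8 else if b = 17 - c then -8 else 0)"
    if b: "b \<in> {1..<17}" for b
  proof -
    have na: "\<not> 17 dvd a" using ac by (metis dvd_imp_mod_0 dvd_mult2 zero_neq_one)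
    have nb: "\<not> 17 dvd int b" using b zdvd_imp_le[of 17 "int b"] by auto
    have "\<not> 17 dvd a * int b" using na nb prime_dvd_mult_iff[of "17::int" a "int b"] by simp
    moreover have "a * int b mod 17 = 1 \<longleftrightarrow> b = c"
    proof
      assume "a * int b mod 17 = 1"
      then have "[a * int b = a * int c] (mod 17)" using ac by (simp add: cong_def)
      then have "[int b = int c] (mod 17)"
        using na by (simp add: cong_mult_lcancel coprime_17_iff)
      then show "b = c" using b c by (simp add: cong_def)
    qed (use ac in simp)
    moreover have "a * int b mod 17 = 16 \<longleftrightarrow> b = 17 - c"
    proof -
      have neg: "a * int (17 - c) mod 17 = 16"
      proof -
        have "a * int (17 - c) = - (a * int c) + a * 17" using c by (simp add: of_nat_diff algebra_simps)
        then have "a * int (17 - c) mod 17 = (- (a * int c)) mod 17"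
          by (simp only: mod_mult_self1)
        then show ?thesis using ac by (simp add: zmod_zminus1_eq_if)
      qed
      show ?thesis
      proof
        assume "a * int b mod 17 = 16"
        then have "[a * int b = a * int (17 - c)] (mod 17)" using neg by (simp add: cong_def)
        then have "[int b = int (17 - c)] (mod 17)"
          using na by (simp add: cong_mult_lcancel coprime_17_iff)
        then have "int b = int (17 - c)"
          by (intro cong_less_imp_eq_int[of "int b" 17]) (use b c in auto)
        then show "b = 17 - c" by (simp only: of_nat_eq_iff)
      qed (use neg in simp)
    qed
    ultimately show ?thesis unfolding X_def by (subst sum_odd_characters_17) simp_all
  qed
  have cal: "calE17 (a * int b mod 17) \<tau> = 2 / 16 * (\<Sum>chi\<in>X. chi a * chi (int b) * E1 chi \<tau>)" for b
    unfolding calE17_mod_minus(1) unfolding calE17_def X_def[symmetric]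
    by (intro arg_cong[of _ _ "\<lambda>x. 2 / 16 * x"] sum.cong refl arg_cong[of _ _ "\<lambda>x. x * E1 _ \<tau>"] mult)
  have "(\<Sum>b=1..<17. (1/2 - of_nat b / 17) * calE17 (a * int b mod 17) \<tau>) =
      (\<Sum>b=1..<17. \<Sum>chi\<in>X. 1/8 * ((1/2 - of_nat b / 17) * (chi a * chi (int b) * E1 chi \<tau>)))"
    unfolding cal sum_distrib_left by (intro sum.cong refl) simp
  also have "\<dots> = (\<Sum>chi\<in>X. \<Sum>b=1..<17. 1/8 * ((1/2 - of_nat b / 17) * (chi a * chi (int b) * E1 chi \<tau>)))"
    by (rule sum.swap)
  also have "\<dots> = (\<Sum>chi\<in>X. 1/8 * chi a * ((\<Sum>b=1..<17. (1/2 - of_nat b / 17) * chi (int b)) * E1 chi \<tau>))"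
    by (simp add: sum_distrib_left sum_distrib_right mult_ac)
  also have "\<dots> = (\<Sum>chi\<in>X. 1/8 * chi a * (\<Sum>b=1..<17. chi (int b) * s b))"
    by (intro sum.cong refl) (simp only: E1)
  also have "\<dots> = (\<Sum>chi\<in>X. \<Sum>b=1..<17. 1/8 * (chi (a * int b) * s b))"
  proof (intro sum.cong refl)
    fix chi assume "chi \<in> X"
    then show "1/8 * chi a * (\<Sum>b=1..<17. chi (int b) * s b) = (\<Sum>b=1..<17. 1/8 * (chi (a * int b) * s b))"
      using mult[of chi] by (simp add: sum_distrib_left mult_ac)
  qed
  also have "\<dots> = (\<Sum>b=1..<17. \<Sum>chi\<in>X. 1/8 * (chi (a * int b) * s b))"
    by (rule sum.swap)
  also have "\<dots> = (\<Sum>b=1..<17. 1/8 * ((\<Sum>chi\<in>X. chi (a * int b)) * s b))"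
    by (simp add: sum_distrib_left sum_distrib_right)
  also have "\<dots> = (\<Sum>b=1..<17. (if b = c then s b else 0) + (if b = 17 - c then - s b else 0))"
  proof (intro sum.cong refl)
    have "c \<noteq> 17 - c" using c by presburger
    then show "1/8 * ((\<Sum>chi\<in>X. chi (a * int b)) * s b) = (if b = c then s b else 0) + (if b = 17 - c then - s b else 0)"
      if "b \<in> {1..<17}" for b
      using orth[OF that] by simp
  qed
  also have "\<dots> = s c - s (17 - c)"
  proof -
    have "1 \<le> 17 - c" using c by auto
    then show ?thesis using c by (simp add: sum.distrib)
  qed
  also have "\<dots> = 2 * s c"
    using lambert_s_U_reflect(1)[OF q, of c 17] c by (simp add: s_def)
  finally show ?thesis by (simp add: s_def q_def)
qed

section \<open>The quadratic relations\<close>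

text \<open>
  Here \<open>t i\<close> is \<open>34 s i\<close>. The multipliers in the proof solve a linear system over the rationals.
\<close>
lemma quadratic_relations:
  fixes e1 e2 e3 e4 e5 e6 e7 e8 t1 t2 t3 t4 t5 t6 t7 t8 u1 u2 u3 u4 u5 u6 u7 u8 :: complex
  assumes t: "t1 = 15*e1 + 13*e2 + 11*e3 + 9*e4 + 7*e5 + 5*e6 + 3*e7 + 1*e8"
    "t2 = 13*e1 + 9*e2 + 5*e3 + 1*e4 - 3*e5 - 7*e6 - 11*e7 - 15*e8"
    "t3 = 11*e1 + 5*e2 - 1*e3 - 7*e4 - 13*e5 + 15*e6 + 9*e7 + 3*e8"
    "t4 = 9*e1 + 1*e2 - 7*e3 - 15*e4 + 11*e5 + 3*e6 - 5*e7 - 13*e8"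
    "t5 = 7*e1 - 3*e2 - 13*e3 + 11*e4 + 1*e5 - 9*e6 + 15*e7 + 5*e8"
    "t6 = 5*e1 - 7*e2 + 15*e3 + 3*e4 - 9*e5 + 13*e6 + 1*e7 - 11*e8"
    "t7 = 3*e1 - 11*e2 + 9*e3 - 5*e4 + 15*e5 + 1*e6 - 13*e7 + 7*e8"
    "t8 = 1*e1 - 15*e2 + 3*e3 - 13*e4 + 5*e5 - 11*e6 + 7*e7 - 9*e8"
    and r: "t2 * (t1 + t1) - t1 * t1 + u1 + u1 + u2 = 0"
    "t3 * (t1 + t2) - t1 * t2 + u1 + u2 + u3 = 0"
    "t4 * (t1 + t3) - t1 * t3 + u1 + u3 + u4 = 0"
    "t5 * (t1 + t4) - t1 * t4 + u1 + u4 + u5 = 0"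
    "t6 * (t1 + t5) - t1 * t5 + u1 + u5 + u6 = 0"
    "t7 * (t1 + t6) - t1 * t6 + u1 + u6 + u7 = 0"
    "t8 * (t1 + t7) - t1 * t7 + u1 + u7 + u8 = 0"
    "(-t8) * (t1 + t8) - t1 * t8 + u1 + u8 + u8 = 0"
    "t4 * (t2 + t2) - t2 * t2 + u2 + u2 + u4 = 0"
    "t5 * (t2 + t3) - t2 * t3 + u2 + u3 + u5 = 0"
    "t6 * (t2 + t4) - t2 * t4 + u2 + u4 + u6 = 0"
    "t7 * (t2 + t5) - t2 * t5 + u2 + u5 + u7 = 0"
    "t8 * (t2 + t6) - t2 * t6 + u2 + u6 + u8 = 0"
    "(-t8) * (t2 + t7) - t2 * t7 + u2 + u7 + u8 = 0"
    "t6 * (t3 + t3) - t3 * t3 + u3 + u3 + u6 = 0"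
    "t7 * (t3 + t4) - t3 * t4 + u3 + u4 + u7 = 0"
    "t8 * (t3 + t5) - t3 * t5 + u3 + u5 + u8 = 0"
    "(-t8) * (t3 + t6) - t3 * t6 + u3 + u6 + u8 = 0"
    "(-t7) * (t3 + t7) - t3 * t7 + u3 + u7 + u7 = 0"
    "t8 * (t4 + t4) - t4 * t4 + u4 + u4 + u8 = 0"
    "(-t8) * (t4 + t5) - t4 * t5 + u4 + u5 + u8 = 0"
    "(-t7) * (t4 + t6) - t4 * t6 + u4 + u6 + u7 = 0"
    "(-t7) * (t5 + t5) - t5 * t5 + u5 + u5 + u7 = 0"
    "(-t6) * (t5 + t6) - t5 * t6 + u5 + u6 + u6 = 0"
  shows "-3 * e2 * e3 + 2 * e7 * e3 + 3 * (-e4) * e3 + e2 * e7 + e2 * e8 + 3 * e2 * (-e6) - 3 * e5 * (-e6) + 3 * e7 * (-e6) - e2 * (-e4) - 3 * e7 * (-e4) - 3 * (-e6) * (-e4) = 0"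
    "-9 * e2 * e3 + 5 * e7 * e3 + 9 * (-e4) * e3 - 5 * e2 * e7 - 5 * e2 * e8 + 9 * e1 * (-e6) + 9 * e2 * (-e6) + 9 * e7 * (-e6) + 5 * e2 * (-e4) - 9 * (-e6) * (-e4) = 0"
    "-3 * e1 * e5 - 3 * e7 * e5 + 3 * e1 * e7 + e2 * e7 + 2 * e3 * e7 + e2 * e8 - 3 * e2 * (-e6) - 3 * e7 * (-e6) + 2 * e2 * (-e4) = 0"
    "-9 * e2 * e3 + 7 * e7 * e3 + 9 * e8 * e3 + 2 * e2 * e7 + 2 * e2 * e8 + 9 * e7 * (-e6) + 7 * e2 * (-e4) - 9 * e7 * (-e4) = 0"
    "16 * e2 * e7 - 16 * e3 * e7 + 9 * e8 * e7 + 9 * e1 * e8 + 16 * e2 * e8 - 9 * e2 * (-e6) - 7 * e2 * (-e4) = 0"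
    "e2 * e7 - 3 * e3 * e5 + 2 * e3 * e7 + e2 * e8 - e2 * (-e4) - 3 * e7 * (-e4) = 0"
proof -
  \<comment> \<open>The factor \<open>1156 = 34^2\<close> comes from the scaling of
    \<open>t\<close>; \<open>-e4\<close> and \<open>-e6\<close> stand for \<open>E 13\<close> and
    \<open>E 11\<close>. Each identity below becomes polynomial once \<open>t\<close> is
    substituted, with the \<open>u\<close> cancelling, and every summand on its right vanishes by
    \<open>r\<close>.\<close>
  have nz: "x = 0" if "1156 * x = 0" for x :: complex using that by simp
  have "1156 * (-3 * e2 * e3 + 2 * e7 * e3 + 3 * (-e4) * e3 + e2 * e7 + e2 * e8 + 3 * e2 * (-e6) - 3 * e5 * (-e6) + 3 * e7 * (-e6) - e2 * (-e4) - 3 * e7 * (-e4) - 3 * (-e6) * (-e4)) = (3) * (t5 * (t1 + t4) - t1 * t4 + u1 + u4 + u5) + (-1) * (t6 * (t1 + t5) - t1 * t5 + u1 + u5 + u6) + (-2) * ((-t8) * (t1 + t8) - t1 * t8 + u1 + u8 + u8) + (-3) * (t5 * (t2 + t3) - t2 * t3 + u2 + u3 + u5) + (1) * (t6 * (t2 + t4) - t2 * t4 + u2 + u4 + u6) + (-3) * (t7 * (t2 + t5) - t2 * t5 + u2 + u5 + u7) + (3) * (t8 * (t2 + t6) - t2 * t6 + u2 + u6 + u8) + (2) * ((-t8) * (t2 + t7) - t2 * t7 + u2 + u7 + u8) + (3) * (t7 * (t3 + t4) - t3 * t4 + u3 + u4 + u7) + (-3) * (t8 * (t4 + t4) - t4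 * t4 + u4 + u4 + u8) + (2) * ((-t8) * (t4 + t5) - t4 * t5 + u4 + u5 + u8) + (-3) * ((-t7) * (t4 + t6) - t4 * t6 + u4 + u6 + u7) + (1) * ((-t7) * (t5 + t5) - t5 * t5 + u5 + u5 + u7)"
    unfolding t by Groebner_Basis.algebra
  then show "-3 * e2 * e3 + 2 * e7 * e3 + 3 * (-e4) * e3 + e2 * e7 + e2 * e8 + 3 * e2 * (-e6) - 3 * e5 * (-e6) + 3 * e7 * (-e6) - e2 * (-e4) - 3 * e7 * (-e4) - 3 * (-e6) * (-e4) = 0"
    unfolding r mult_zero_right add_0 by (rule nz)
  have "1156 * (-9 * e2 * e3 + 5 * e7 * e3 + 9 * (-e4) * e3 - 5 * e2 * e7 - 5 * e2 * e8 + 9 * e1 * (-e6) + 9 * e2 * (-e6) + 9 * e7 * (-e6) + 5 * e2 * (-e4) - 9 * (-e6) * (-e4)) = (9) * (t2 * (t1 + t1) - t1 * t1 + u1 + u1 + u2) + (-9) * (t4 * (t1 + t3) - t1 * t3 + u1 + u3 + u4) + (-4) * (t6 * (t1 + t5) - t1 * t5 + u1 + u5 + u6) + (9) * (t7 * (t1 + t6) - t1 * t6 + u1 + u6 + u7) + (-14) * ((-t8) * (t1 + t8) - t1 * t8 + u1 + u8 + u8) + (-5) * (t6 * (t2 + t4) - t2 * t4 + u2 + u4 + u6) + (-9) * (t7 * (t2 + t5) - t2 * t5 + u2 + u5 + u7) + (5) * ((-t8) * (t2 + t7) - t2 * t7 + u2 + u7 + u8) + (9) * (t8 * (t3 + t5)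 - t3 * t5 + u3 + u5 + u8) + (14) * ((-t8) * (t4 + t5) - t4 * t5 + u4 + u5 + u8) + (-5) * ((-t7) * (t5 + t5) - t5 * t5 + u5 + u5 + u7)"
    unfolding t by Groebner_Basis.algebra
  then show "-9 * e2 * e3 + 5 * e7 * e3 + 9 * (-e4) * e3 - 5 * e2 * e7 - 5 * e2 * e8 + 9 * e1 * (-e6) + 9 * e2 * (-e6) + 9 * e7 * (-e6) + 5 * e2 * (-e4) - 9 * (-e6) * (-e4) = 0"
    unfolding r mult_zero_right add_0 by (rule nz)
  have "1156 * (-3 * e1 * e5 - 3 * e7 * e5 + 3 * e1 * e7 + e2 * e7 + 2 * e3 * e7 + e2 * e8 - 3 * e2 * (-e6) - 3 * e7 * (-e6) + 2 * e2 * (-e4)) = (3) * (t3 * (t1 + t2) - t1 * t2 + u1 + u2 + u3) + (-3) * (t4 * (t1 + t3) - t1 * t3 + u1 + u3 + u4) + (-3) * (t5 * (t1 + t4) - t1 * t4 + u1 + u4 + u5) + (2) * (t6 * (t1 + t5) - t1 * t5 + u1 + u5 + u6) + (1) * ((-t8) * (t1 + t8) - t1 * t8 + u1 + u8 + u8) + (3) * (t5 * (t2 + t3) - t2 * t3 + u2 + u3 + u5) + (1) * (t6 * (t2 + t4) - t2 * t4 + u2 + u4 + u6) + (-3) * (t7 * (t2 + t5) - t2 * t5 + u2 + u5 + u7) + (-4) * ((-t8) * (t2 + t7) - t2 * t7 + u2 + u7 + u8) + (-3) * (t6 * (t3 + t3) - t3 * t3 + u3 + u3 + u6) + (3) * (t8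 * (t3 + t5) - t3 * t5 + u3 + u5 + u8) + (-3) * ((-t8) * (t3 + t6) - t3 * t6 + u3 + u6 + u8) + (3) * ((-t7) * (t3 + t7) - t3 * t7 + u3 + u7 + u7) + (2) * ((-t8) * (t4 + t5) - t4 * t5 + u4 + u5 + u8) + (3) * ((-t7) * (t4 + t6) - t4 * t6 + u4 + u6 + u7) + (-2) * ((-t7) * (t5 + t5) - t5 * t5 + u5 + u5 + u7)"
    unfolding t by Groebner_Basis.algebra
  then show "-3 * e1 * e5 - 3 * e7 * e5 + 3 * e1 * e7 + e2 * e7 + 2 * e3 * e7 + e2 * e8 - 3 * e2 * (-e6) - 3 * e7 * (-e6) + 2 * e2 * (-e4) = 0"
    unfolding r mult_zero_right add_0 by (rule nz)
  have "1156 * (-9 * e2 * e3 + 7 * e7 * e3 + 9 * e8 * e3 + 2 * e2 * e7 + 2 * e2 * e8 + 9 * e7 * (-e6) + 7 * e2 * (-e4) - 9 * e7 * (-e4)) = (-9) * (t4 * (t1 + t3) - t1 * t3 + u1 + u3 + u4) + (9) * (t5 * (t1 + t4) - t1 * t4 + u1 + u4 + u5) + (-2) * (t6 * (t1 + t5) - t1 * t5 + u1 + u5 + u6) + (9) * (t7 * (t1 + t6) - t1 * t6 + u1 + u6 + u7) + (-7) * ((-t8) * (t1 + t8) - t1 * t8 + u1 + u8 + u8) + (9) * (t4 * (t2 + t2) - t2 * t2 + u2 + u2 + u4) + (-9) * (t5 * (t2 + t3) - t2 * t3 + u2 + u3 + u5) + (2) * (t6 * (t2 + t4) - t2 * t4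 + u2 + u4 + u6) + (-9) * (t7 * (t2 + t5) - t2 * t5 + u2 + u5 + u7) + (-2) * ((-t8) * (t2 + t7) - t2 * t7 + u2 + u7 + u8) + (9) * (t8 * (t3 + t5) - t3 * t5 + u3 + u5 + u8) + (9) * ((-t8) * (t3 + t6) - t3 * t6 + u3 + u6 + u8) + (-9) * (t8 * (t4 + t4) - t4 * t4 + u4 + u4 + u8) + (7) * ((-t8) * (t4 + t5) - t4 * t5 + u4 + u5 + u8) + (2) * ((-t7) * (t5 + t5) - t5 * t5 + u5 + u5 + u7) + (-9) * ((-t6) * (t5 + t6) - t5 * t6 + u5 + u6 + u6)"
    unfolding t by Groebner_Basis.algebra
  then show "-9 * e2 * e3 + 7 * e7 * e3 + 9 * e8 * e3 + 2 * e2 * e7 + 2 * e2 * e8 + 9 * e7 * (-e6) + 7 * e2 * (-e4) - 9 * e7 * (-e4) = 0"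
    unfolding r mult_zero_right add_0 by (rule nz)
  have "1156 * (16 * e2 * e7 - 16 * e3 * e7 + 9 * e8 * e7 + 9 * e1 * e8 + 16 * e2 * e8 - 9 * e2 * (-e6) - 7 * e2 * (-e4)) = (9) * (t3 * (t1 + t2) - t1 * t2 + u1 + u2 + u3) + (-9) * (t4 * (t1 + t3) - t1 * t3 + u1 + u3 + u4) + (-9) * (t5 * (t1 + t4) - t1 * t4 + u1 + u4 + u5) + (-16) * (t6 * (t1 + t5) - t1 * t5 + u1 + u5 + u6) + (9) * (t7 * (t1 + t6) - t1 * t6 + u1 + u6 + u7) + (16) * ((-t8) * (t1 + t8) - t1 * t8 + u1 + u8 + u8) + (9) * (t5 * (t2 + t3) - t2 * t3 + u2 + u3 + u5) + (16) * (t6 * (t2 + t4) - t2 * t4 + u2 + u4 + u6) + (-9) * (t8 * (t2 + t6) - t2 * t6 + u2 + u6 + u8) + (-25) * ((-t8) * (t2 + t7) - t2 * t7 + u2 + u7 + u8) + (-9) * (t6 * (t3 + t3) - t3 * t3 + u3 + u3 + u6) + (9) * (t8 * (t3 + t5) - t3 * t5 + u3 + u5 + u8) + (-7) * ((-t8) * (t4 + t5) - t4 * t5 + u4 + u5 + u8) + (9) * ((-t7) * (t4 + t6) - t4 * t6 + u4 + u6 + u7) + (7) * ((-t7) * (t5 + t5) - t5 * t5 + u5 + u5 + u7)"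
    unfolding t by Groebner_Basis.algebra
  then show "16 * e2 * e7 - 16 * e3 * e7 + 9 * e8 * e7 + 9 * e1 * e8 + 16 * e2 * e8 - 9 * e2 * (-e6) - 7 * e2 * (-e4) = 0"
    unfolding r mult_zero_right add_0 by (rule nz)
  have "1156 * (e2 * e7 - 3 * e3 * e5 + 2 * e3 * e7 + e2 * e8 - e2 * (-e4) - 3 * e7 * (-e4)) = (3) * (t5 * (t1 + t4) - t1 * t4 + u1 + u4 + u5) + (-1) * (t6 * (t1 + t5) - t1 * t5 + u1 + u5 + u6) + (-3) * (t7 * (t1 + t6) - t1 * t6 + u1 + u6 + u7) + (1) * ((-t8) * (t1 + t8) - t1 * t8 + u1 + u8 + u8) + (-3) * (t5 * (t2 + t3) - t2 * t3 + u2 + u3 + u5) + (1) * (t6 * (t2 + t4) - t2 * t4 + u2 + u4 + u6) + (3) * (t8 * (t2 + t6) - t2 * t6 + u2 + u6 + u8) + (-1) * ((-t8) * (t2 + t7) - t2 * t7 + u2 + u7 + u8) + (3) * (t7 * (t3 + t4) - t3 * t4 + u3 + u4 + u7) + (-3) * (t8 * (t4 + t4) - t4 * t4 + u4 + u4 + u8) + (-1) * ((-t8) * (t4 + t5) - t4 * t5 + u4 + u5 + u8) + (1) * ((-t7) * (t5 + t5) - t5 * t5 + u5 + u5 + u7)"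
    unfolding t by Groebner_Basis.algebra
  then show "e2 * e7 - 3 * e3 * e5 + 2 * e3 * e7 + e2 * e8 - e2 * (-e4) - 3 * e7 * (-e4) = 0"
    unfolding r mult_zero_right add_0 by (rule nz)
qed

theorem theorem5p4:
  fixes \<tau> :: complex
  assumes "Im \<tau> > 0"
  shows "let E = (\<lambda>a. calE17 a \<tau>) in
      -3 * E 2 * E 3 + 2 * E 7 * E 3 + 3 * E 13 * E 3 + E 2 * E 7 + E 2 * E 8 + 3 * E 2 * E 11 - 3 * E 5 * E 11 + 3 * E 7 * E 11 - E 2 * E 13 - 3 * E 7 * E 13 - 3 * E 11 * E 13 = 0 \<and>
      -9 * E 2 * E 3 + 5 * E 7 * E 3 + 9 * E 13 * E 3 - 5 * E 2 * E 7 - 5 * E 2 * E 8 + 9 * E 1 * E 11 + 9 * E 2 * E 11 + 9 * E 7 * E 11 + 5 * E 2 * E 13 - 9 * E 11 * E 13 = 0 \<and>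
      -3 * E 1 * E 5 - 3 * E 7 * E 5 + 3 * E 1 * E 7 + E 2 * E 7 + 2 * E 3 * E 7 + E 2 * E 8 - 3 * E 2 * E 11 - 3 * E 7 * E 11 + 2 * E 2 * E 13 = 0 \<and>
      -9 * E 2 * E 3 + 7 * E 7 * E 3 + 9 * E 8 * E 3 + 2 * E 2 * E 7 + 2 * E 2 * E 8 + 9 * E 7 * E 11 + 7 * E 2 * E 13 - 9 * E 7 * E 13 = 0 \<and>
      16 * E 2 * E 7 - 16 * E 3 * E 7 + 9 * E 8 * E 7 + 9 * E 1 * E 8 + 16 * E 2 * E 8 - 9 * E 2 * E 11 - 7 * E 2 * E 13 = 0 \<and>
      E 2 * E 7 - 3 * E 3 * E 5 + 2 * E 3 * E 7 + E 2 * E 8 - E 2 * E 13 - 3 * E 7 * E 13 = 0"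
proof -
  define q where "q = exp (2 * of_real pi * \<i> * \<tau>)"
  \<comment> \<open>Scaling by 34 turns the weights \<open>1/2 - b/17\<close> into the integers
    \<open>17 - 2 b\<close>; the quadratic relations then require \<open>34^2 = 1156\<close> for
    \<open>u\<close>.\<close>
  define s where "s = (\<lambda>b. 34 * lambert_s 17 q b)"
  define u where "u = (\<lambda>b. 1156 * lambert_U 17 q b)"
  define E where "E = (\<lambda>a. calE17 a \<tau>)"
  have q: "q \<noteq> 0" "norm q < 1" using assms by (simp_all add: q_def)
  have refl_s: "s (17 - b) = - s b" and refl_u: "u (17 - b) = u b" if "1 \<le> b" "b < 17" for b
    using lambert_s_U_reflect[OF q that] by (simp_all add: s_def u_def)
  have s_neg: "s 9 = - s 8" "s 10 = - s 7" "s 11 = - s 6" "s 12 = - s 5"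
    "s 13 = - s 4" "s 14 = - s 3" "s 15 = - s 2" "s 16 = - s 1"
    using refl_s[of 8] refl_s[of 7] refl_s[of 6] refl_s[of 5] refl_s[of 4] refl_s[of 3] refl_s[of 2] refl_s[of 1] by simp_all
  have u_sym: "u 9 = u 8" "u 10 = u 7" "u 11 = u 6" "u 12 = u 5" "u 13 = u 4" "u 14 = u 3" "u 15 = u 2" "u 16 = u 1"
    using refl_u[of 8] refl_u[of 7] refl_u[of 6] refl_u[of 5] refl_u[of 4] refl_u[of 3] refl_u[of 2] refl_u[of 1] by simp_all
  have E_neg: "E 9 = - E 8" "E 10 = - E 7" "E 11 = - E 6" "E 12 = - E 5"
    "E 13 = - E 4" "E 14 = - E 3" "E 15 = - E 2" "E 16 = - E 1"
    using calE17_mod_minus[of "-8" \<tau>] calE17_mod_minus[of "-7" \<tau>] calE17_mod_minus[of "-6" \<tau>]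
      calE17_mod_minus[of "-5" \<tau>] calE17_mod_minus[of "-4" \<tau>] calE17_mod_minus[of "-3" \<tau>]
      calE17_mod_minus[of "-2" \<tau>] calE17_mod_minus[of "-1" \<tau>]
    by (simp_all add: E_def)
  have E_reflect: "E (a * (17 - b) mod 17) = - E (a * b mod 17)" for a b
  proof -
    have "a * (17 - b) = - (a * b) + a * 17" by (simp add: algebra_simps)
    then show ?thesis by (simp only: E_def calE17_mod_minus mod_mult_self1 mod_minus_eq)
  qed
  \<comment> \<open>Under \<open>b\<close> to \<open>17 - b\<close> both the weight and
    \<open>E\<close> change sign, so the sum over 16 residues is twice the sum over
    \<open>b = 1\<close> to \<open>8\<close>.\<close>
  have s_eq: "s c = 15 * E (a * 1 mod 17) + 13 * E (a * 2 mod 17) + 11 * E (a * 3 mod 17)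
      + 9 * E (a * 4 mod 17) + 7 * E (a * 5 mod 17) + 5 * E (a * 6 mod 17)
      + 3 * E (a * 7 mod 17) + E (a * 8 mod 17)" (is "_ = ?r")
    if "c \<in> {1..<17}" "a * int c mod 17 = 1" for a c
  proof -
    have "2 * s c = 34 * (\<Sum>b=1..<17. (1/2 - of_nat b / 17) * E (a * int b mod 17))"
      using lambert_s_eq_sum_calE17[OF assms that] by (simp add: s_def q_def E_def)
    also have "\<dots> = (\<Sum>b=1..<17. (17 - 2 * of_nat b) * E (a * int b mod 17))"
      unfolding sum_distrib_left by (intro sum.cong refl) (simp add: field_simps)
    also have "\<dots> = 2 * ?r"
      unfolding sum_1_17
      using E_reflect[of a 1] E_reflect[of a 2] E_reflect[of a 3] E_reflect[of a 4]
        E_reflect[of a 5] E_reflect[of a 6] E_reflect[of a 7] E_reflect[of a 8]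
      by (simp add: algebra_simps)
    finally show ?thesis by (simp only: mult_left_cancel zero_neq_numeral[symmetric] not_False_eq_True)
  qed
  have s_u: "s c * (s a + s b) - s a * s b + u a + u b + u c = 0"
    if "1 \<le> a" "1 \<le> b" "c < 17" "a + b = c" for a b c
  proof -
    have "s c * (s a + s b) - s a * s b + u a + u b + u c =
      1156 * (lambert_s 17 q (a + b) * (lambert_s 17 q a + lambert_s 17 q b) - lambert_s 17 q a * lambert_s 17 q b
        + lambert_U 17 q a + lambert_U 17 q b + lambert_U 17 q (a + b))"
      by (simp add: s_def u_def that(4)[symmetric] algebra_simps)
    also have "\<dots> = 1156 * 0"
      by (subst lambert_s_U_relation) (use q that in auto)
    finally show ?thesis by simp
  qed
  \<comment> \<open>The second argument given to \<open>s_eq\<close> is the inverse of the first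
    modulo 17; reducing the indices \<open>a b\<close> modulo 17 and then to \<open>1..8\<close> by
    \<open>E_neg\<close> produces the signs.\<close>
  have t: "s 1 = 15 * E 1 + 13 * E 2 + 11 * E 3 + 9 * E 4 + 7 * E 5 + 5 * E 6 + 3 * E 7 + 1 * E 8"
    "s 2 = 13 * E 1 + 9 * E 2 + 5 * E 3 + 1 * E 4 - 3 * E 5 - 7 * E 6 - 11 * E 7 - 15 * E 8"
    "s 3 = 11 * E 1 + 5 * E 2 - 1 * E 3 - 7 * E 4 - 13 * E 5 + 15 * E 6 + 9 * E 7 + 3 * E 8"
    "s 4 = 9 * E 1 + 1 * E 2 - 7 * E 3 - 15 * E 4 + 11 * E 5 + 3 * E 6 - 5 * E 7 - 13 * E 8"
    "s 5 = 7 * E 1 - 3 * E 2 - 13 * E 3 + 11 * E 4 + 1 * E 5 - 9 * E 6 + 15 * E 7 + 5 * E 8"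
    "s 6 = 5 * E 1 - 7 * E 2 + 15 * E 3 + 3 * E 4 - 9 * E 5 + 13 * E 6 + 1 * E 7 - 11 * E 8"
    "s 7 = 3 * E 1 - 11 * E 2 + 9 * E 3 - 5 * E 4 + 15 * E 5 + 1 * E 6 - 13 * E 7 + 7 * E 8"
    "s 8 = 1 * E 1 - 15 * E 2 + 3 * E 3 - 13 * E 4 + 5 * E 5 - 11 * E 6 + 7 * E 7 - 9 * E 8"
    using s_eq[of 1 1] s_eq[of 2 9] s_eq[of 3 6] s_eq[of 4 13] s_eq[of 5 7] s_eq[of 6 3] s_eq[of 7 5] s_eq[of 8 15]
    by (simp_all add: E_neg)
  \<comment> \<open>One relation for each of the 24 unordered triples
    \<open>a <= b <= 17 - (a + b)\<close> of positive integers with sum 17. Indices above 8 are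
    reflected, which accounts for the factors \<open>- s 8\<close>, \<open>- s 7\<close> and
    \<open>- s 6\<close>.\<close>
  have r: "s 2 * (s 1 + s 1) - s 1 * s 1 + u 1 + u 1 + u 2 = 0"
    "s 3 * (s 1 + s 2) - s 1 * s 2 + u 1 + u 2 + u 3 = 0"
    "s 4 * (s 1 + s 3) - s 1 * s 3 + u 1 + u 3 + u 4 = 0"
    "s 5 * (s 1 + s 4) - s 1 * s 4 + u 1 + u 4 + u 5 = 0"
    "s 6 * (s 1 + s 5) - s 1 * s 5 + u 1 + u 5 + u 6 = 0"
    "s 7 * (s 1 + s 6) - s 1 * s 6 + u 1 + u 6 + u 7 = 0"
    "s 8 * (s 1 + s 7) - s 1 * s 7 + u 1 + u 7 + u 8 = 0"
    "(- s 8) * (s 1 + s 8) - s 1 * s 8 + u 1 + u 8 + u 8 = 0"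
    "s 4 * (s 2 + s 2) - s 2 * s 2 + u 2 + u 2 + u 4 = 0"
    "s 5 * (s 2 + s 3) - s 2 * s 3 + u 2 + u 3 + u 5 = 0"
    "s 6 * (s 2 + s 4) - s 2 * s 4 + u 2 + u 4 + u 6 = 0"
    "s 7 * (s 2 + s 5) - s 2 * s 5 + u 2 + u 5 + u 7 = 0"
    "s 8 * (s 2 + s 6) - s 2 * s 6 + u 2 + u 6 + u 8 = 0"
    "(- s 8) * (s 2 + s 7) - s 2 * s 7 + u 2 + u 7 + u 8 = 0"
    "s 6 * (s 3 + s 3) - s 3 * s 3 + u 3 + u 3 + u 6 = 0"
    "s 7 * (s 3 + s 4) - s 3 * s 4 + u 3 + u 4 + u 7 = 0"
    "s 8 * (s 3 + s 5) - s 3 * s 5 + u 3 + u 5 + u 8 = 0"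
    "(- s 8) * (s 3 + s 6) - s 3 * s 6 + u 3 + u 6 + u 8 = 0"
    "(- s 7) * (s 3 + s 7) - s 3 * s 7 + u 3 + u 7 + u 7 = 0"
    "s 8 * (s 4 + s 4) - s 4 * s 4 + u 4 + u 4 + u 8 = 0"
    "(- s 8) * (s 4 + s 5) - s 4 * s 5 + u 4 + u 5 + u 8 = 0"
    "(- s 7) * (s 4 + s 6) - s 4 * s 6 + u 4 + u 6 + u 7 = 0"
    "(- s 7) * (s 5 + s 5) - s 5 * s 5 + u 5 + u 5 + u 7 = 0"
    "(- s 6) * (s 5 + s 6) - s 5 * s 6 + u 5 + u 6 + u 6 = 0"
    apply (rule s_u[of 1 1 2, unfolded s_neg u_sym]; simp)
    apply (rule s_u[of 1 2 3, unfolded s_neg u_sym]; simp)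
    apply (rule s_u[of 1 3 4, unfolded s_neg u_sym]; simp)
    apply (rule s_u[of 1 4 5, unfolded s_neg u_sym]; simp)
    apply (rule s_u[of 1 5 6, unfolded s_neg u_sym]; simp)
    apply (rule s_u[of 1 6 7, unfolded s_neg u_sym]; simp)
    apply (rule s_u[of 1 7 8, unfolded s_neg u_sym]; simp)
    apply (rule s_u[of 1 8 9, unfolded s_neg u_sym]; simp)
    apply (rule s_u[of 2 2 4, unfolded s_neg u_sym]; simp)
    apply (rule s_u[of 2 3 5, unfolded s_neg u_sym]; simp)
    apply (rule s_u[of 2 4 6, unfolded s_neg u_sym]; simp)
    apply (rule s_u[of 2 5 7, unfolded s_neg u_sym]; simp)
    apply (rule s_u[of 2 6 8, unfolded s_neg u_sym]; simp)
    apply (rule s_u[of 2 7 9, unfolded s_neg u_sym]; simp)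
    apply (rule s_u[of 3 3 6, unfolded s_neg u_sym]; simp)
    apply (rule s_u[of 3 4 7, unfolded s_neg u_sym]; simp)
    apply (rule s_u[of 3 5 8, unfolded s_neg u_sym]; simp)
    apply (rule s_u[of 3 6 9, unfolded s_neg u_sym]; simp)
    apply (rule s_u[of 3 7 10, unfolded s_neg u_sym]; simp)
    apply (rule s_u[of 4 4 8, unfolded s_neg u_sym]; simp)
    apply (rule s_u[of 4 5 9, unfolded s_neg u_sym]; simp)
    apply (rule s_u[of 4 6 10, unfolded s_neg u_sym]; simp)
    apply (rule s_u[of 5 5 10, unfolded s_neg u_sym]; simp)
    apply (rule s_u[of 5 6 11, unfolded s_neg u_sym]; simp)
    done
  have E: "calE17 a \<tau> = E a" for a by (simp add: E_def)
  show ?thesis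
    unfolding Let_def E E_neg
    by (intro conjI quadratic_relations[OF t r])
qed

end
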